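(* Let $d\in\mathbb{N}$ and let $K\subset\mathbb{R}^d$ be non-empty. Then: (i) If $K$ is compact, there is an $x\in K$ such that $\dim_{A}(K,x)\geq\overline{\dim}_{B} K$. (ii) If $K$ is analytic, then for any $s\geq 0$ such that $\mathcal{H}^s(K)>0$, there is a compact set $E\subset K$ with $\mathcal{H}^s(E)>0$ so that for each $x\in E$ there is a tangent $F\in\operatorname{Tan}(\overline{K},x)$ with $\mathcal{H}^{s}_\infty(F)\geq 1$.
   Context: $\mathbb{R}^d$ has the Euclidean metric, $B(x,r)$ is the closed ball with centre $x$ and radius $r$, and $\overline{K}$ is the closure of $K$. For a bounded set $E$, $N_r(E)$ is the smallest number of closed balls of radius $r$ needed to cover $E$. $\overline{\dim}_B$ is upper box dimension and $\mathcal{H}^s$ is $s$-dimensional Hausdorff measure, defined using sums $\sum_i(\operatorname{diam} U_i)^s$ (no further normalizing constant). The Hausdorff $s$-content is $$\mathcal{H}^s_\infty(E)=\inf\Bigl\{\sum_{i=1}^\infty(\operatorname{diam} U_i)^s:E\subset\bigcup_{i=1}^\infty U_i,\ U_i\text{ open}\Bigr\}.$$ For compact $K$ and $x\in K$, the pointwise Assouad dimension is $$\dim_A(K,x)=\inf\Bigl\{s:\exists C>0\ \exists\rho>0\ \forall\,0<r\leq R<\rho,\ N_r(B(x,R)\cap K)\leq C\Bigl(\frac{R}{r}\Bigr)^s\Bigr\}.$$ For a set $X\subset\mathbb{R}^d$ and $x\in X$, a non-empty compact set $F\subset B(0,1)$ is a tangent of $X$ at $x$, written $F\in\operatorname{Tan}(X,x)$,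 if there is a sequence $(\lambda_k)_{k=1}^\infty$ of positive reals diverging to infinity such that $F=\lim_{k\to\infty}\lambda_k(X-x)\cap B(0,1)$ in the Hausdorff metric on non-empty compact subsets of $B(0,1)$. *)

theory Defs
  imports "HOL-Analysis.Analysis"
begin

text \<open>Only meaningful for totally bounded \<open>E\<close>; the centres are not required to lie in \<open>E\<close>.\<close>

definition covering_number :: "real \<Rightarrow> 'a::metric_space set \<Rightarrow> nat" where
  "covering_number r E =
     (LEAST n. \<exists>C. finite C \<and> card C = n \<and> E \<subseteq> (\<Union>x\<in>C. cball x r))"

definition upper_box_dim :: "'a::metric_space set \<Rightarrow> ereal" where
  "upper_box_dim E =
     Limsup (at_right 0) (\<lambda>r. ereal (ln (real (covering_number r E)) / ln (1 / r)))"

definition pointwise_Assouad_dim :: "'a::metric_space set \<Rightarrow> 'a \<Rightarrow> ereal" where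
  "pointwise_Assouad_dim K x =
     Inf {ereal s | s. \<exists>C>0. \<exists>\<rho>>0. \<forall>r R. 0 < r \<and> r \<le> R \<and> R < \<rho> \<longrightarrow>
       real (covering_number r (cball x R \<inter> K)) \<le> C * (R / r) powr s}"

text \<open>
  The quantity \<open>(diam U)\<^sup>s\<close> with the usual conventions for Hausdorff measures: the empty set
  contributes 0 for every \<open>s \<ge> 0\<close>, and a non-empty set contributes 1 for \<open>s = 0\<close>, so that
  \<open>\<H>\<^sup>0\<close> is counting measure. Neither is given by \<open>diameter U powr s\<close>, since \<open>0 powr 0 = 0\<close>,
  and \<open>diameter\<close> is unspecified on unbounded sets.
\<close>

definition diam_power :: "real \<Rightarrow> 'a::metric_space set \<Rightarrow> ennreal" where
  "diam_power s U =
     (if U = {} then 0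
      else if s = 0 then 1
      else if bounded U then ennreal (diameter U powr s)
      else \<infinity>)"

definition Hausdorff_premeasure :: "real \<Rightarrow> real \<Rightarrow> 'a::metric_space set \<Rightarrow> ennreal" where
  "Hausdorff_premeasure s \<delta> E =
     (INF U \<in> {U :: nat \<Rightarrow> 'a set.
         E \<subseteq> (\<Union>i. U i) \<and> (\<forall>i. bounded (U i) \<and> diameter (U i) \<le> \<delta>)}.
       \<Sum>i. diam_power s (U i))"

definition Hausdorff_measure :: "real \<Rightarrow> 'a::metric_space set \<Rightarrow> ennreal" where
  "Hausdorff_measure s E = (SUP \<delta> \<in> {0<..}. Hausdorff_premeasure s \<delta> E)"

definition Hausdorff_content :: "real \<Rightarrow> 'a::metric_space set \<Rightarrow> ennreal" where
  "Hausdorff_content s E =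
     (INF U \<in> {U :: nat \<Rightarrow> 'a set. E \<subseteq> (\<Union>i. U i) \<and> (\<forall>i. open (U i))}.
       \<Sum>i. diam_power s (U i))"

text \<open>Only meaningful for non-empty bounded sets.\<close>

definition Hausdorff_dist :: "'a::metric_space set \<Rightarrow> 'a set \<Rightarrow> real" where
  "Hausdorff_dist A B = max (SUP a\<in>A. infdist a B) (SUP b\<in>B. infdist b A)"

definition blowup :: "'a::real_normed_vector set \<Rightarrow> 'a \<Rightarrow> real \<Rightarrow> 'a set" where
  "blowup X x c = (\<lambda>y. c *\<^sub>R (y - x)) ` X \<inter> cball 0 1"

text \<open>
  Convergence takes place in the space of non-empty compact subsets of \<open>cball 0 1\<close>, so the
  blow-ups are required to belong to that space. This is automatic when \<open>X\<close> is a closed subset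
  of a Euclidean space and \<open>x \<in> X\<close>.
\<close>

definition Tan :: "'a::real_normed_vector set \<Rightarrow> 'a \<Rightarrow> 'a set set" where
  "Tan X x = {F. F \<noteq> {} \<and> compact F \<and> F \<subseteq> cball 0 1 \<and>
     (\<exists>c :: nat \<Rightarrow> real. (\<forall>k. 0 < c k) \<and> filterlim c at_top sequentially \<and>
        (\<forall>k. blowup X x (c k) \<noteq> {} \<and> compact (blowup X x (c k))) \<and>
        (\<lambda>k. Hausdorff_dist (blowup X x (c k)) F) \<longlonglongrightarrow> 0)}"

text \<open>
  Analytic sets as continuous images of the Baire space: \<open>nat \<Rightarrow> nat\<close> carries the product of
  the discrete topologies.
\<close>

definition analytic_set :: "'a::topological_space set \<Rightarrow> bool" where
  "analytic_set A \<longleftrightarrow>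
     A = {} \<or> (\<exists>f :: (nat \<Rightarrow> nat) \<Rightarrow> 'a. continuous_on UNIV f \<and> range f = A)"

end

theory Submission
  imports Defs "HOL-Complex_Analysis.Great_Picard"
begin

text \<open>
  (i) If every pointwise Assouad dimension were smaller than the upper box dimension, finitely many
  of the balls witnessing this would cover \<open>K\<close>, and adding up their covering numbers would
  contradict the definition of the upper box dimension.

  (ii) Dyadic net content is continuous from below, so an analytic set of positive measure contains
  a compact set \<open>K'\<close> of positive content. Fix \<open>q < 1\<close>. Except for a null set, each point of \<open>K'\<close>
  lies in arbitrarily small open sets \<open>U\<close> such that \<open>K' \<inter> U\<close> has content more than
  \<open>q (diam U)\<^sup>s\<close>: on the exceptional set every fine cover could be improved by the factor \<open>q\<close>,
  so its content \<open>h\<close> satisfies \<open>h \<le> q h\<close>. Rescaling such sets \<open>U\<close> to diameter 1 while \<open>q\<close>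
  tends to 1 gives blow-ups of content at least \<open>q\<close>, and content is upper semicontinuous along
  Hausdorff convergent sequences of compact sets.
\<close>

section \<open>Box dimension and pointwise Assouad dimension\<close>

text \<open>Part (ii) must cope with sets of infinite measure. Measure is therefore replaced by
  content, which for positive \<open>s\<close> has the same null sets and is finite on bounded sets;
  this finiteness is what lets \<open>h \<le> q h\<close> force \<open>h = 0\<close>. Two contents
  occur because each has one good limit property. Net content is continuous from below: dyadic cells
  that meet are nested, so countably many covers can be merged and thinned to maximal cells, and no
  part of the set is paid for twice. Hausdorff content behaves well from above, since its covering
  sets are open: a cheap cover of a compact set also covers a neighbourhood. The first property
  handles boxes bounding finitely many coordinates of the Baire space; the second handles the
  passage to the box bounding all of them, and later the limit of blow-ups. The contents are
  compared up to a constant in one direction and only on null sets in the other, which is enough to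
  transfer positivity.\<close>

lemma covering_number_least:
  assumes "finite C" "E \<subseteq> (\<Union>x\<in>C. cball x r)"
  shows "covering_number r E \<le> card C"
  unfolding covering_number_def using assms by (intro Least_le) blast

text \<open>Without a finite cover, \<open>LEAST\<close> would be an unspecified number; boundedness
  in a Heine-Borel space gives total boundedness, so the minimum is attained.\<close>

lemma covering_number_witness:
  fixes E :: "'a::heine_borel set"
  assumes "bounded E" "0 < r"
  obtains C where "finite C" "card C = covering_number r E" "E \<subseteq> (\<Union>x\<in>C. cball x r)"
proof -
  have "compact (closure E)" using assms by simp
  then obtain k where k: "finite k" "closure E \<subseteq> (\<Union>x\<in>k. ball x r)"
    using \<open>0 < r\<close> unfolding compact_eq_totally_bounded by metis
  then have "E \<subseteq> (\<Union>x\<in>k. cball x r)"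
    using closure_subset[of E] ball_subset_cball by blast
  with k have "\<exists>n C. finite C \<and> card C = n \<and> E \<subseteq> (\<Union>x\<in>C. cball x r)" by blast
  from LeastI_ex[OF this] show ?thesis
    using that unfolding covering_number_def by blast
qed

lemma covering_number_UN_le:
  fixes K :: "'a::heine_borel set"
  assumes "finite I" "K \<subseteq> (\<Union>i\<in>I. E i)" "\<And>i. i \<in> I \<Longrightarrow> bounded (E i)" "0 < r"
  shows "covering_number r K \<le> (\<Sum>i\<in>I. covering_number r (E i))"
proof -
  have "\<exists>C. finite C \<and> card C = covering_number r (E i) \<and> E i \<subseteq> (\<Union>x\<in>C. cball x r)" if "i \<in> I" for i
    using covering_number_witness[OF assms(3)[OF that] assms(4)] by metis
  then obtain C where C: "\<And>i. i \<in> I \<Longrightarrow> finite (C i) \<and> card (C i) = covering_number r (E i) \<and>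
      E i \<subseteq> (\<Union>x\<in>C i. cball x r)" by metis
  have "K \<subseteq> (\<Union>x\<in>(\<Union>i\<in>I. C i). cball x r)"
    using assms(2) C by fastforce
  then have "covering_number r K \<le> card (\<Union>i\<in>I. C i)"
    using assms(1) C by (intro covering_number_least) auto
  also have "\<dots> \<le> (\<Sum>i\<in>I. card (C i))" using assms(1) by (rule card_UN_le)
  also have "\<dots> = (\<Sum>i\<in>I. covering_number r (E i))" using C by (intro sum.cong) auto
  finally show ?thesis .
qed

lemma covering_number_ge_1:
  fixes K :: "'a::heine_borel set"
  assumes "bounded K" "K \<noteq> {}" "0 < r"
  shows "1 \<le> covering_number r K"
proof -
  obtain C where "finite C" "card C = covering_number r K" "K \<subseteq> (\<Union>x\<in>C. cball x r)"
    using covering_number_witness assms by metis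
  moreover from this have "C \<noteq> {}" using assms by auto
  ultimately show ?thesis by (metis One_nat_def Suc_leI card_gt_0_iff)
qed

text \<open>After taking logarithms, the constant \<open>A\<close> contributes
  \<open>ln A / ln (1 / r)\<close>, which vanishes as \<open>r\<close> tends to 0.\<close>

lemma upper_box_dim_le:
  fixes K :: "'a::heine_borel set"
  assumes K: "bounded K" "K \<noteq> {}" and A: "0 < A"
    and le: "\<forall>\<^sub>F r in at_right 0. real (covering_number r K) \<le> A * r powr - t"
  shows "upper_box_dim K \<le> ereal t"
proof -
  let ?g = "\<lambda>r. ereal (ln A / ln (1 / r) + t)"
  have "\<forall>\<^sub>F r in at_right 0. (r::real) \<in> {0<..<1}"
    by (rule eventually_at_right_real) simp
  then have "\<forall>\<^sub>F r in at_right 0. ereal (ln (real (covering_number r K)) / ln (1 / r)) \<le> ?g r"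
    using le
  proof eventually_elim
    case (elim r)
    have pos: "ln (1 / r) > 0" using elim by (simp add: ln_div)
    have "ln (real (covering_number r K)) \<le> ln (A * r powr - t)"
      using elim covering_number_ge_1[OF K, of r] A by (subst ln_le_cancel_iff) auto
    also have "\<dots> = ln A + t * ln (1 / r)"
      using A elim by (simp add: ln_mult ln_powr ln_div)
    finally show ?case using pos by (simp add: field_simps)
  qed
  then have "upper_box_dim K \<le> Limsup (at_right 0) ?g"
    unfolding upper_box_dim_def by (rule Limsup_mono)
  also have "Limsup (at_right 0) ?g = ereal t"
  proof (rule lim_imp_Limsup)
    have "((\<lambda>r::real. ln A / ln (1 / r) + t) \<longlongrightarrow> 0 + t) (at_right 0)"
      by (intro tendsto_add tendsto_const tendsto_divide_0[OF tendsto_const]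
          filterlim_at_top_imp_at_infinity filterlim_compose[OF ln_at_top])
         (use filterlim_inverse_at_top_right in \<open>simp add: inverse_eq_divide\<close>)
    then show "(?g \<longlongrightarrow> ereal t) (at_right 0)" by simp
  qed simp
  finally show ?thesis .
qed

theorem exists_pointwise_Assouad_dim_ge:
  fixes K :: "'a::heine_borel set"
  assumes "compact K" "K \<noteq> {}"
  shows "\<exists>x\<in>K. upper_box_dim K \<le> pointwise_Assouad_dim K x"
proof (rule ccontr)
  assume "\<not> ?thesis"
  then have "\<forall>x\<in>K. \<exists>s C \<rho>. ereal s < upper_box_dim K \<and> 0 < C \<and> 0 < \<rho> \<and>
      (\<forall>r R. 0 < r \<and> r \<le> R \<and> R < \<rho> \<longrightarrow>
         real (covering_number r (cball x R \<inter> K)) \<le> C * (R / r) powr s)"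
    unfolding pointwise_Assouad_dim_def not_le bex_simps ball_simps Inf_less_iff by blast
  then obtain s C \<rho> where s: "\<And>x. x \<in> K \<Longrightarrow> ereal (s x) < upper_box_dim K"
    and pos: "\<And>x. x \<in> K \<Longrightarrow> (0::real) < C x" "\<And>x. x \<in> K \<Longrightarrow> (0::real) < \<rho> x"
    and N: "\<And>x r R. x \<in> K \<Longrightarrow> 0 < r \<Longrightarrow> r \<le> R \<Longrightarrow> R < \<rho> x \<Longrightarrow>
         real (covering_number r (cball x R \<inter> K)) \<le> C x * (R / r) powr (s x)"
    unfolding bchoice_iff by blast
  \<comment> \<open>Half of \<open>\<rho> x\<close> keeps the radius strictly below the bound
    demanded in \<open>N\<close>.\<close>
  have "K \<subseteq> (\<Union>x\<in>K. ball x (\<rho> x / 2))" using pos by force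
  then obtain I where I: "I \<subseteq> K" "finite I" "K \<subseteq> (\<Union>x\<in>I. ball x (\<rho> x / 2))"
    using compactE_image[OF assms(1), of K "\<lambda>x. ball x (\<rho> x / 2)"] by auto
  then have "I \<noteq> {}" using assms by auto
  \<comment> \<open>Only finitely many exponents remain, so their maximum is still strictly below
    the upper box dimension.\<close>
  define t where "t = Max (s ` I)"
  have t: "ereal t < upper_box_dim K" "\<And>x. x \<in> I \<Longrightarrow> s x \<le> t"
  proof -
    have "t \<in> s ` I" unfolding t_def using I \<open>I \<noteq> {}\<close> by (intro Max_in) auto
    then show "ereal t < upper_box_dim K" using s I by auto
    show "\<And>x. x \<in> I \<Longrightarrow> s x \<le> t" using I unfolding t_def by simp
  qed
  \<comment> \<open>With \<open>R\<close> frozen at \<open>\<rho> x / 2\<close>, each bound is a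
    constant times \<open>r powr - s x\<close>; \<open>A\<close> collects the constants.\<close>
  define A where "A = (\<Sum>x\<in>I. C x * (\<rho> x / 2) powr s x)"
  have "0 < A" unfolding A_def 
  proof (rule sum_pos)
    fix x assume "x \<in> I"
    then have "x \<in> K" using I by blast
    then show "0 < C x * (\<rho> x / 2) powr s x" using pos[of x] by simp
  qed (use I \<open>I \<noteq> {}\<close> in auto)
  \<comment> \<open>\<open>r \<le> \<rho> x / 2\<close> is what the Assouad bound asks for;
    \<open>r \<le> 1\<close> allows the exponent \<open>s x\<close> to be raised to
    \<open>t\<close>.\<close>
  have ev: "\<forall>\<^sub>F r in at_right 0. 0 < r \<and> r \<le> 1 \<and> (\<forall>x\<in>I. r \<le> \<rho> x / 2)"
  proof -
    have e: "\<forall>\<^sub>F r in at_right 0. 0 < r \<and> r \<le> a" if "0 < a" for a :: real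
      using eventually_at_right_real[OF that] by eventually_elim auto
    have "\<forall>\<^sub>F r in at_right 0. \<forall>x\<in>I. 0 < r \<and> r \<le> \<rho> x / 2"
    proof (rule eventually_ball_finite)
      show "\<forall>x\<in>I. \<forall>\<^sub>F r in at_right 0. 0 < r \<and> r \<le> \<rho> x / 2"
      proof
        fix x assume "x \<in> I"
        then have "0 < \<rho> x / 2" using I pos(2)[of x] by auto
        then show "\<forall>\<^sub>F r in at_right 0. 0 < r \<and> r \<le> \<rho> x / 2" by (rule e)
      qed
    qed (use I in simp)
    with e[OF zero_less_one] show ?thesis by eventually_elim auto
  qed
  have "upper_box_dim K \<le> ereal t"
  proof (rule upper_box_dim_le[OF compact_imp_bounded[OF assms(1)] assms(2) \<open>0 < A\<close>])
    show "\<forall>\<^sub>F r in at_right 0. real (covering_number r K) \<le> A * r powr - t"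
      using ev
    proof eventually_elim
      case (elim r)
      have "K \<subseteq> (\<Union>x\<in>I. cball x (\<rho> x / 2) \<inter> K)"
        using I(3) ball_subset_cball by blast
      then have "covering_number r K \<le> (\<Sum>x\<in>I. covering_number r (cball x (\<rho> x / 2) \<inter> K))"
        using elim I by (intro covering_number_UN_le) (auto simp: bounded_Int)
      then have "real (covering_number r K) \<le> (\<Sum>x\<in>I. real (covering_number r (cball x (\<rho> x / 2) \<inter> K)))"
        by (metis of_nat_le_iff of_nat_sum)
      also have "\<dots> \<le> (\<Sum>x\<in>I. C x * (\<rho> x / 2) powr s x * r powr - t)"
      proof (rule sum_mono)
        fix x assume x: "x \<in> I"
        have "real (covering_number r (cball x (\<rho> x / 2) \<inter> K)) \<le> C x * (\<rho> x / 2 / r) powr s x"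
          using elim x I pos(2)[of x] by (intro N) (auto simp: subset_iff)
        also have "\<dots> = C x * (\<rho> x / 2) powr s x * r powr - s x"
          using x I pos(2)[of x] elim by (subst powr_divide) (auto simp: powr_minus_divide)
        also have "\<dots> \<le> C x * (\<rho> x / 2) powr s x * r powr - t"
          using x I pos(1)[of x] elim t(2)[OF x]
          by (intro mult_left_mono powr_mono') (auto simp: subset_iff less_imp_le)
        finally show "real (covering_number r (cball x (\<rho> x / 2) \<inter> K)) \<le>
          C x * (\<rho> x / 2) powr s x * r powr - t" .
      qed
      finally show ?case by (simp add: A_def sum_distrib_right)
    qed
  qed
  with t(1) show False by simp
qed

section \<open>Hausdorff content\<close>

lemma diam_power_empty [simp]: "diam_power s {} = 0"
  by (simp add: diam_power_def)

text \<open>This is how a small total cost forces a fine cover: every single term is below the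
  bound, and \<open>t powr s\<close> increases with \<open>t\<close>.\<close>

lemma diam_power_less_imp:
  assumes "0 < s" "0 < \<delta>" "diam_power s U < ennreal (\<delta> powr s)"
  shows "bounded U" "diameter U < \<delta>"
proof -
  show b: "bounded U" using assms by (auto simp: diam_power_def split: if_splits)
  show "diameter U < \<delta>"
  proof (cases "U = {}")
    case False
    then have "ennreal (diameter U powr s) < ennreal (\<delta> powr s)"
      using assms b by (simp add: diam_power_def)
    then have "diameter U powr s < \<delta> powr s" by (simp add: ennreal_less_iff)
    then show ?thesis
      using assms powr_mono2[of s \<delta> "diameter U"] by (meson not_le less_imp_le)
  qed (use assms in simp)
qed

lemma diam_power_le:
  assumes "0 < s" "bounded U" "diameter U \<le> d"
  shows "diam_power s U \<le> ennreal (d powr s)"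
  using assms diameter_ge_0[OF assms(2)] by (auto simp: diam_power_def intro!: ennreal_leI powr_mono2)

text \<open>The \<open>r\<close>-neighbourhood adds at most \<open>2 * r\<close> to the diameter,
  and \<open>t powr s\<close> is right-continuous, even at diameter 0 because
  \<open>0 < s\<close>.\<close>

lemma diam_power_open_superset:
  fixes U :: "'a::real_normed_vector set"
  assumes "0 < s" "0 < e"
  obtains V where "open V" "U \<subseteq> V" "diam_power s V \<le> diam_power s U + ennreal e"
proof -
  consider "U = {}" | "\<not> bounded U" | "U \<noteq> {}" "bounded U" by blast
  then show ?thesis
  proof cases
    case 1
    then show ?thesis using that[of "{}"] by simp
  next
    case 2
    then have "U \<noteq> {}" by auto
    with 2 show ?thesis using that[of UNIV] assms by (simp add: diam_power_def)
  next
    case 3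
    let ?D = "diameter U"
    have "0 \<le> ?D" using 3 by (simp add: diameter_ge_0)
    have "((\<lambda>r. (?D + 2 * r) powr s) \<longlongrightarrow> (?D + 2 * 0) powr s) (at_right 0)"
    proof (rule tendsto_powr')
      show "?D + 2 * 0 \<noteq> 0 \<or> 0 < s \<and> (\<forall>\<^sub>F r in at_right 0. 0 \<le> ?D + 2 * r)"
        using assms \<open>0 \<le> ?D\<close> eventually_at_right_less[of "0::real"]
        by (auto elim!: eventually_mono)
      show "((\<lambda>r. ?D + 2 * r) \<longlongrightarrow> ?D + 2 * 0) (at_right 0)" by (intro tendsto_intros)
    qed (rule tendsto_const)
    then have "\<forall>\<^sub>F r in at_right 0. (?D + 2 * r) powr s < ?D powr s + e"
      using assms by (intro order_tendstoD) auto
    then have "\<forall>\<^sub>F r in at_right 0. 0 < r \<and> (?D + 2 * r) powr s < ?D powr s + e"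
      using eventually_at_right_less[of "0::real"] by eventually_elim auto
    then obtain r where r: "0 < r" "(?D + 2 * r) powr s < ?D powr s + e"
      by (metis (no_types, lifting) eventually_happens trivial_limit_at_right_real)
    define V where "V = (\<Union>x\<in>U. ball x r)"
    have dV: "dist x y \<le> ?D + 2 * r" if "x \<in> V" "y \<in> V" for x y
    proof -
      obtain x' y' where x': "x' \<in> U" "dist x' x < r" "y' \<in> U" "dist y' y < r"
        using \<open>x \<in> V\<close> \<open>y \<in> V\<close> unfolding V_def by auto
      have "dist x' y' \<le> ?D" using 3 x' by (intro diameter_bounded_bound)
      then show ?thesis using x' dist_triangle[of x y x'] dist_triangle[of x' y y']
        by (simp add: dist_commute)
    qed
    have "bounded V" unfolding bounded_two_points using dV by blast
    moreover have "diameter V \<le> ?D + 2 * r"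
      using dV r \<open>0 \<le> ?D\<close> by (intro diameter_le) (auto simp: dist_norm)
    ultimately have "diam_power s V \<le> ennreal ((?D + 2 * r) powr s)"
      by (intro diam_power_le assms)
    also have "\<dots> \<le> ennreal (?D powr s + e)" using r by (intro ennreal_leI) simp
    also have "\<dots> = diam_power s U + ennreal e"
      using 3 assms by (simp add: diam_power_def)
    finally have "diam_power s V \<le> diam_power s U + ennreal e" .
    moreover have "open V" "U \<subseteq> V" using r unfolding V_def by auto
    ultimately show ?thesis by (intro that)
  qed
qed

lemma Hausdorff_content_le:
  "\<lbrakk>E \<subseteq> (\<Union>i. U i); \<And>i. open (U i)\<rbrakk> \<Longrightarrow> Hausdorff_content s E \<le> (\<Sum>i. diam_power s (U i))"
  unfolding Hausdorff_content_def by (rule INF_lower) auto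

lemma Hausdorff_content_less_cover:
  assumes "Hausdorff_content s E < c"
  obtains U where "E \<subseteq> (\<Union>i. U i)" "\<And>i. open (U i)" "(\<Sum>i. diam_power s (U i)) < c"
  using assms unfolding Hausdorff_content_def INF_less_iff by blast

lemma Hausdorff_content_mono: "E \<subseteq> F \<Longrightarrow> Hausdorff_content s E \<le> Hausdorff_content s F"
  unfolding Hausdorff_content_def by (rule INF_superset_mono) auto

text \<open>Outer regularity, immediate because the covering sets are open: their union has the same
  cover. All limits from above rest on it.\<close>

lemma Hausdorff_content_less_open:
  assumes "Hausdorff_content s E < c"
  obtains V where "open V" "E \<subseteq> V" "Hausdorff_content s V < c"
proof -
  obtain U where U: "E \<subseteq> (\<Union>i. U i)" "\<And>i. open (U i)" "(\<Sum>i. diam_power s (U i)) < c"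
    using Hausdorff_content_less_cover[OF assms] by metis
  then show ?thesis
    using that[of "\<Union>i. U i"] Hausdorff_content_le[of "\<Union>i. U i" U s]
    by (meson open_UN order.strict_trans1 order_refl)
qed

lemma Hausdorff_content_open_le: "open U \<Longrightarrow> Hausdorff_content s U \<le> diam_power s U"
  using Hausdorff_content_le[of U "\<lambda>i. if i = 0 then U else {}" s]
    suminf_finite[of "{0::nat}" "\<lambda>i. diam_power s (if i = 0 then U else {})"] by simp

lemma Hausdorff_content_empty [simp]: "Hausdorff_content s {} = 0"
  using Hausdorff_content_open_le[of "{}" s] by simp

text \<open>Bookkeeping for distributing an error \<open>e\<close> over countably many near optimal
  choices.\<close>

lemma suminf_add_half_series:
  assumes "0 \<le> e"
  shows "(\<Sum>i. f i + ennreal (e * (1 / 2) ^ Suc i)) = (\<Sum>i. f i) + ennreal e"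
proof -
  have "(\<Sum>i. f i + ennreal (e * (1 / 2) ^ Suc i)) = (\<Sum>i. f i) + (\<Sum>i. ennreal (e * (1 / 2) ^ Suc i))"
    by (rule suminf_add[symmetric]) auto
  also have "(\<Sum>i. ennreal (e * (1 / 2) ^ Suc i)) = ennreal e"
    using sums_mult[OF power_half_series, of e] assms by (intro suminf_ennreal_eq) auto
  finally show ?thesis .
qed

lemma Hausdorff_content_UN_le:
  "Hausdorff_content s (\<Union>i. A i) \<le> (\<Sum>i. Hausdorff_content s (A i))"
proof (rule ennreal_le_epsilon)
  fix e :: real assume fin: "(\<Sum>i. Hausdorff_content s (A i)) < top" and "0 < e"
  have "\<exists>U. A i \<subseteq> (\<Union>j. U j) \<and> (\<forall>j. open (U j)) \<and>
    (\<Sum>j. diam_power s (U j)) \<le> Hausdorff_content s (A i) + ennreal (e * (1 / 2) ^ Suc i)" for i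
  proof -
    have "Hausdorff_content s (A i) < top" using ennreal_suminf_lessD[OF fin] .
    moreover have "0 < ennreal (e * (1 / 2) ^ Suc i)"
      using \<open>0 < e\<close> by simp
    ultimately have "Hausdorff_content s (A i) < Hausdorff_content s (A i) + ennreal (e * (1 / 2) ^ Suc i)"
      using ennreal_add_left_cancel_less[of "Hausdorff_content s (A i)" 0] by simp
    from Hausdorff_content_less_cover[OF this] show ?thesis by (metis less_imp_le)
  qed
  then obtain U where U: "\<And>i. A i \<subseteq> (\<Union>j. U i j)" "\<And>i j. open (U i j)"
    "\<And>i. (\<Sum>j. diam_power s (U i j)) \<le> Hausdorff_content s (A i) + ennreal (e * (1 / 2) ^ Suc i)"
    by metis
  let ?V = "\<lambda>n. case_prod U (prod_decode n)"
  have "(\<Union>i. A i) \<subseteq> (\<Union>n. ?V n)"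
  proof
    fix x assume "x \<in> (\<Union>i. A i)"
    then obtain i j where "x \<in> U i j" using U(1) by blast
    then have "x \<in> ?V (prod_encode (i, j))" by simp
    then show "x \<in> (\<Union>n. ?V n)" by (rule UN_I[OF UNIV_I])
  qed
  then have "Hausdorff_content s (\<Union>i. A i) \<le> (\<Sum>n. diam_power s (?V n))"
    using U(2) by (intro Hausdorff_content_le) (auto split: prod.split)
  also have "\<dots> = (\<Sum>i. \<Sum>j. diam_power s (U i j))"
    using suminf_ennreal_2dimen[of "\<lambda>i. \<Sum>j. diam_power s (U i j)" "\<lambda>(i, j). diam_power s (U i j)"]
    by (simp add: case_prod_beta)
  also have "\<dots> \<le> (\<Sum>i. Hausdorff_content s (A i) + ennreal (e * (1 / 2) ^ Suc i))"
    by (intro suminf_le U(3)) auto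
  finally show "Hausdorff_content s (\<Union>i. A i) \<le> (\<Sum>i. Hausdorff_content s (A i)) + ennreal e"
    using \<open>0 < e\<close> by (simp only: suminf_add_half_series less_imp_le)
qed

lemma Hausdorff_content_Un_le:
  "Hausdorff_content s (A \<union> B) \<le> Hausdorff_content s A + Hausdorff_content s B"
proof -
  let ?A = "\<lambda>i::nat. if i = 0 then A else if i = 1 then B else {}"
  have "A \<union> B \<subseteq> (\<Union>i. ?A i)" by (auto split: if_splits)
  then have "Hausdorff_content s (A \<union> B) \<le> (\<Sum>i. Hausdorff_content s (?A i))"
    by (rule order_trans[OF Hausdorff_content_mono Hausdorff_content_UN_le])
  also have "\<dots> = (\<Sum>i\<in>{0, 1}. Hausdorff_content s (?A i))"
    by (rule suminf_finite) auto
  finally show ?thesis by simp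
qed

lemma Hausdorff_content_finite_UN_eq_0:
  "finite I \<Longrightarrow> (\<And>i. i \<in> I \<Longrightarrow> Hausdorff_content s (A i) = 0) \<Longrightarrow> Hausdorff_content s (\<Union>i\<in>I. A i) = 0"
proof (induction I rule: finite_induct)
  case (insert i I)
  then show ?case
    using Hausdorff_content_Un_le[of s "A i" "\<Union>i\<in>I. A i"] by simp
qed simp

text \<open>Each covering set is enlarged to an open one at an extra cost from a series with sum
  \<open>e\<close>. This admits the covers of the premeasure and covers by dyadic cells, which are
  not open.\<close>

lemma Hausdorff_content_le_cover:
  fixes E :: "'a::real_normed_vector set"
  assumes "0 < s" "E \<subseteq> (\<Union>i. U i)"
  shows "Hausdorff_content s E \<le> (\<Sum>i. diam_power s (U i))"
proof (rule ennreal_le_epsilon)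
  fix e :: real assume "0 < e"
  have "\<exists>V. open V \<and> U i \<subseteq> V \<and> diam_power s V \<le> diam_power s (U i) + ennreal (e * (1 / 2) ^ Suc i)" for i
  proof -
    have "0 < e * (1 / 2) ^ Suc i" using \<open>0 < e\<close> by simp
    then show ?thesis using diam_power_open_superset[OF assms(1), of "e * (1 / 2) ^ Suc i" "U i"]
      by metis
  qed
  then obtain V where V: "\<And>i. open (V i)" "\<And>i. U i \<subseteq> V i"
    "\<And>i. diam_power s (V i) \<le> diam_power s (U i) + ennreal (e * (1 / 2) ^ Suc i)" by metis
  have "Hausdorff_content s E \<le> (\<Sum>i. diam_power s (V i))"
    by (rule Hausdorff_content_le[OF order_trans[OF assms(2) UN_mono[OF order_refl V(2)]] V(1)])
  also have "\<dots> \<le> (\<Sum>i. diam_power s (U i) + ennreal (e * (1 / 2) ^ Suc i))"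
    by (intro suminf_le V(3)) auto
  finally show "Hausdorff_content s E \<le> (\<Sum>i. diam_power s (U i)) + ennreal e"
    using \<open>0 < e\<close> by (simp only: suminf_add_half_series less_imp_le)
qed

lemma Hausdorff_content_le_measure:
  fixes E :: "'a::real_normed_vector set"
  assumes "0 < s"
  shows "Hausdorff_content s E \<le> Hausdorff_measure s E"
proof -
  have "Hausdorff_content s E \<le> Hausdorff_premeasure s 1 E"
    unfolding Hausdorff_premeasure_def
    by (rule INF_greatest) (use Hausdorff_content_le_cover[OF assms] in auto)
  also have "\<dots> \<le> Hausdorff_measure s E"
    unfolding Hausdorff_measure_def by (rule SUP_upper) simp
  finally show ?thesis .
qed

text \<open>A cover of cost below \<open>\<delta> powr s\<close> has all diameters below
  \<open>\<delta>\<close>, so arbitrarily cheap covers are automatically fine.\<close>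

lemma Hausdorff_measure_eq_0:
  assumes "0 < s" "Hausdorff_content s E = 0"
  shows "Hausdorff_measure s E = 0"
proof -
  have "Hausdorff_premeasure s \<delta> E \<le> 0 + ennreal e" if "0 < \<delta>" "0 < e" for \<delta> e :: real
  proof -
    have "Hausdorff_content s E < min (ennreal e) (ennreal (\<delta> powr s))"
      using assms that by simp
    then obtain U where U: "E \<subseteq> (\<Union>i. U i)" "(\<Sum>i. diam_power s (U i)) < min (ennreal e) (ennreal (\<delta> powr s))"
      using Hausdorff_content_less_cover by metis
    have "diam_power s (U i) < ennreal (\<delta> powr s)" for i
      using U(2) ennreal_suminf_lessD[of "\<lambda>i. diam_power s (U i)"] by simp
    then have "bounded (U i) \<and> diameter (U i) \<le> \<delta>" for i
      using diam_power_less_imp[OF assms(1) \<open>0 < \<delta>\<close>] by (meson less_imp_le)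
    then have "Hausdorff_premeasure s \<delta> E \<le> (\<Sum>i. diam_power s (U i))"
      unfolding Hausdorff_premeasure_def using U(1) by (intro INF_lower) auto
    also have "\<dots> \<le> 0 + ennreal e" using U(2) by (simp add: less_imp_le)
    finally show ?thesis .
  qed
  then have "Hausdorff_premeasure s \<delta> E \<le> 0" if "0 < \<delta>" for \<delta>
    using ennreal_le_epsilon that by blast
  then show ?thesis unfolding Hausdorff_measure_def by (simp add: SUP_eq_const)
qed

section \<open>Sets on which every fine cover can be improved\<close>

lemma Hausdorff_content_eq_0_small:
  fixes q :: real
  assumes "0 < s" "0 < q" "q < 1" "0 < \<delta>" "A \<subseteq> B" "B \<subseteq> K"
    and small: "Hausdorff_content s A < ennreal (\<delta> powr s)"
    and *: "\<And>U. \<lbrakk>open U; bounded U; diameter U < \<delta>; U \<inter> B \<noteq> {}\<rbrakk> \<Longrightarrow>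
          Hausdorff_content s (K \<inter> U) \<le> ennreal q * diam_power s U"
  shows "Hausdorff_content s A = 0"
proof (rule ccontr)
  obtain a where a: "Hausdorff_content s A = ennreal a" "0 \<le> a"
    using small by (cases "Hausdorff_content s A") auto
  assume "Hausdorff_content s A \<noteq> 0"
  then have "0 < a" using a by (auto simp: less_le)
  \<comment> \<open>The gap between \<open>a\<close> and \<open>a / q\<close> admits a cover whose
    cost, multiplied by \<open>q\<close>, is still below \<open>a\<close>.\<close>
  then have "a < a / q" using assms by (simp add: field_simps)
  then have "Hausdorff_content s A < min (ennreal (a / q)) (ennreal (\<delta> powr s))"
    using small a by (simp add: ennreal_less_iff)
  then obtain U where U: "A \<subseteq> (\<Union>i. U i)" "\<And>i. open (U i)"
    and less: "(\<Sum>i. diam_power s (U i)) < min (ennreal (a / q)) (ennreal (\<delta> powr s))"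
    using Hausdorff_content_less_cover by metis
  have le: "Hausdorff_content s (A \<inter> U i) \<le> ennreal q * diam_power s (U i)" for i
  proof (cases "U i \<inter> B = {}")
    case True
    then have "A \<inter> U i = {}" using assms by blast
    then show ?thesis by simp
  next
    case False
    \<comment> \<open>The bound on the whole sum bounds each diameter, so \<open>*\<close> applies
      to every member that meets \<open>B\<close>.\<close>
    have "diam_power s (U i) < ennreal (\<delta> powr s)"
      using less ennreal_suminf_lessD[of "\<lambda>i. diam_power s (U i)"] by simp
    then have "Hausdorff_content s (K \<inter> U i) \<le> ennreal q * diam_power s (U i)"
      using diam_power_less_imp[OF assms(1,4)] U(2) False by (intro *) auto
    moreover have "Hausdorff_content s (A \<inter> U i) \<le> Hausdorff_content s (K \<inter> U i)"
      using assms by (intro Hausdorff_content_mono) blast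
    ultimately show ?thesis by (rule order_trans[rotated])
  qed
  have "Hausdorff_content s A \<le> Hausdorff_content s (\<Union>i. A \<inter> U i)"
    using U(1) by (intro Hausdorff_content_mono) blast
  also have "\<dots> \<le> (\<Sum>i. Hausdorff_content s (A \<inter> U i))" by (rule Hausdorff_content_UN_le)
  also have "\<dots> \<le> (\<Sum>i. ennreal q * diam_power s (U i))" by (intro suminf_le le) auto
  also have "\<dots> = ennreal q * (\<Sum>i. diam_power s (U i))" by simp
  also have "\<dots> < ennreal q * ennreal (a / q)"
    using less assms by (intro ennreal_mult_strict_left_mono) auto
  also have "\<dots> = ennreal a" using assms \<open>0 < a\<close> by (simp flip: ennreal_mult)
  finally show False using a by simp
qed

lemma Hausdorff_content_Int_ball_le:
  fixes A :: "'a::real_normed_vector set"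
  assumes "0 < s" "0 < r"
  shows "Hausdorff_content s (A \<inter> ball x r) \<le> ennreal ((2 * r) powr s)"
proof -
  have "Hausdorff_content s (A \<inter> ball x r) \<le> diam_power s (ball x r)"
    by (meson Hausdorff_content_mono Hausdorff_content_open_le Int_lower2 open_ball order_trans)
  also have "\<dots> \<le> ennreal ((2 * r) powr s)"
  proof (rule diam_power_le)
    show "diameter (ball x r) \<le> 2 * r"
    proof (rule diameter_le, goal_cases)
      case (2 y z)
      then show ?case using dist_triangle[of y z x] by (simp add: dist_norm norm_minus_commute)
    qed (use assms in auto)
  qed (use assms in auto)
  finally show ?thesis .
qed

text \<open>The content of \<open>B\<close> may be at least \<open>\<delta> powr s\<close>, so
  \<open>B\<close> is cut into finitely many pieces in balls of radius \<open>\<delta> / 4\<close>,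
  each of content at most \<open>(\<delta> / 2) powr s\<close>. This is why
  \<open>Hausdorff_content_eq_0_small\<close> separates the estimated set \<open>A\<close> from the
  exceptional set \<open>B\<close>.\<close>

lemma Hausdorff_content_eq_0:
  fixes B :: "'a::real_normed_vector set"
  assumes "0 < s" "0 < q" "q < 1" "0 < \<delta>" "compact B" "B \<subseteq> K"
    and *: "\<And>U. \<lbrakk>open U; bounded U; diameter U < \<delta>; U \<inter> B \<noteq> {}\<rbrakk> \<Longrightarrow>
          Hausdorff_content s (K \<inter> U) \<le> ennreal q * diam_power s U"
  shows "Hausdorff_content s B = 0"
proof -
  have "0 < \<delta> / 4" using assms by simp
  then obtain C where C: "finite C" "B \<subseteq> (\<Union>x\<in>C. ball x (\<delta> / 4))"
    using assms(5) unfolding compact_eq_totally_bounded by metis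
  have "Hausdorff_content s (B \<inter> ball x (\<delta> / 4)) = 0" for x
  proof (rule Hausdorff_content_eq_0_small[OF assms(1-4) _ assms(6) _ *])
    have "(2 * (\<delta> / 4)) powr s < \<delta> powr s" using assms by (intro powr_less_mono2) auto
    then show "Hausdorff_content s (B \<inter> ball x (\<delta> / 4)) < ennreal (\<delta> powr s)"
      using Hausdorff_content_Int_ball_le[OF assms(1), of "\<delta> / 4" B x] assms(4)
      by (simp add: ennreal_less_iff order.strict_trans1)
  qed auto
  then have "Hausdorff_content s (\<Union>x\<in>C. B \<inter> ball x (\<delta> / 4)) = 0"
    by (intro Hausdorff_content_finite_UN_eq_0 C)
  moreover have "B \<subseteq> (\<Union>x\<in>C. B \<inter> ball x (\<delta> / 4))" using C by blast
  ultimately show ?thesis using Hausdorff_content_mono by (metis le_zero_eq)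
qed

section \<open>Net content on a tree of nested partitions\<close>

text \<open>A sum over an arbitrary, possibly uncountable, set is encoded as a measure for which
  every set is measurable; additivity and countable subadditivity then come from measure
  theory.\<close>

definition weight_measure :: "('b \<Rightarrow> ennreal) \<Rightarrow> 'b measure" where
  "weight_measure v = point_measure UNIV v"

lemma sets_weight_measure [simp]: "sets (weight_measure v) = UNIV"
  by (simp add: weight_measure_def sets_point_measure)

lemma emeasure_weight_measure_finite:
  "finite X \<Longrightarrow> emeasure (weight_measure v) X = (\<Sum>x\<in>X. v x)"
  by (simp add: weight_measure_def emeasure_point_measure_finite2)

text \<open>For finite \<open>c\<close>, bounded partial sums leave only finitely many weights of
  size at least \<open>1 / (n + 1)\<close> for each \<open>n\<close>. The nonzero weights thus sit
  on a countable set, and continuity from below along an enumeration finishes.\<close>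

lemma emeasure_weight_measure_le:
  assumes le: "\<And>F. \<lbrakk>finite F; F \<subseteq> X\<rbrakk> \<Longrightarrow> (\<Sum>x\<in>F. v x) \<le> c"
  shows "emeasure (weight_measure v) X \<le> c"
proof (cases c)
  case (real a)
  define T where "T = {x \<in> X. v x \<noteq> 0}"
  have "finite {x \<in> X. ennreal (1 / real (Suc n)) \<le> v x}" (is "finite ?T") for n
  proof (rule ccontr)
    assume "infinite ?T"
    obtain k :: nat where k: "a * real (Suc n) < real k" using reals_Archimedean2 by blast
    obtain F where F: "finite F" "card F = k" "F \<subseteq> ?T"
      using infinite_arbitrarily_large[OF \<open>infinite ?T\<close>] by blast
    have "ennreal (real k * (1 / real (Suc n))) = of_nat k * ennreal (1 / real (Suc n))"
      by (simp only: ennreal_mult[OF of_nat_0_le_iff zero_le_divide_1_iff[THEN iffD2, OF of_nat_0_le_iff]]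
          ennreal_of_nat_eq_real_of_nat)
    also have "\<dots> = (\<Sum>x\<in>F. ennreal (1 / real (Suc n)))" using F by simp
    also have "\<dots> \<le> (\<Sum>x\<in>F. v x)" using F(3) by (intro sum_mono) blast
    also have "\<dots> \<le> ennreal a" using le[of F] F real(2) by blast
    finally have "real k * (1 / real (Suc n)) \<le> a"
      using real(1) by (simp add: ennreal_le_iff)
    with k show False by (simp add: field_simps)
  qed
  moreover have "T \<subseteq> (\<Union>n. {x \<in> X. ennreal (1 / real (Suc n)) \<le> v x})"
  proof
    fix x assume "x \<in> T"
    then have x: "x \<in> X" "0 < v x" by (auto simp: T_def zero_less_iff_neq_zero)
    then obtain e where e: "0 < e" "ennreal e \<le> v x"
    proof (cases "v x")
      case (real r)
      then show ?thesis using that[of r] x by simp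
    qed (use that[of 1] in auto)
    then obtain n where "1 / real (Suc n) < e" using nat_approx_posE by blast
    then have "ennreal (1 / real (Suc n)) \<le> v x" using e(2) by (meson ennreal_leI less_imp_le order_trans)
    with x show "x \<in> (\<Union>n. {x \<in> X. ennreal (1 / real (Suc n)) \<le> v x})" by blast
  qed
  ultimately have "countable T"
    by (meson countable_UN countable_finite countable_subset countableI_type)
  have "emeasure (weight_measure v) X \<le> emeasure (weight_measure v) T + emeasure (weight_measure v) (X - T)"
    by (rule order_trans[OF emeasure_mono emeasure_subadditive]) auto
  also have "emeasure (weight_measure v) (X - T) = 0"
  proof -
    have "X - T \<in> null_sets (weight_measure v)"
      unfolding weight_measure_def null_sets_point_measure_iff by (auto simp: T_def)
    then show ?thesis by blast
  qed
  also have "emeasure (weight_measure v) T + 0 \<le> c"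
  proof (cases "T = {}")
    case False
    let ?A = "\<lambda>n. from_nat_into T ` {..n::nat}"
    have "T = (\<Union>n. ?A n)"
      using range_from_nat_into[OF False \<open>countable T\<close>] by blast
    then have "emeasure (weight_measure v) T = (SUP n. emeasure (weight_measure v) (?A n))"
      by (subst SUP_emeasure_incseq) (auto simp: incseq_def)
    also have "\<dots> \<le> c"
    proof (rule SUP_least)
      fix n
      have "?A n \<subseteq> X" using from_nat_into[OF False] by (auto simp: T_def)
      then show "emeasure (weight_measure v) (?A n) \<le> c"
        using le[of "?A n"] by (simp add: emeasure_weight_measure_finite)
    qed
    finally show ?thesis by simp
  qed simp
  finally show ?thesis .
qed simp

text \<open>A node of the tree carries its level, since a cell may occur on several levels.\<close>

locale nested_partitions =
  fixes cell :: "nat \<Rightarrow> 'a \<Rightarrow> 'a set" and w :: "nat \<Rightarrow> ennreal"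
  assumes mem_cell: "x \<in> cell n x"
    and cell_eq: "y \<in> cell n x \<Longrightarrow> cell n y = cell n x"
    and cell_Suc: "cell (Suc n) x \<subseteq> cell n x"
    and cell_0: "cell 0 x = UNIV"
    and w_antimono: "m \<le> n \<Longrightarrow> w n \<le> w m"
    and w_finite: "w 0 < top"
begin

definition nodes :: "(nat \<times> 'a set) set" where
  "nodes = {(n, cell n x) | n x. True}"

definition cost :: "nat \<times> 'a set \<Rightarrow> ennreal" where
  "cost p = w (fst p)"

definition total_cost :: "(nat \<times> 'a set) set \<Rightarrow> ennreal" where
  "total_cost N = emeasure (weight_measure cost) N"

definition net_content :: "'a set \<Rightarrow> ennreal" where
  "net_content E = (INF N \<in> {N. N \<subseteq> nodes \<and> E \<subseteq> (\<Union>p\<in>N. snd p)}. total_cost N)"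

lemma cell_antimono: "m \<le> n \<Longrightarrow> cell n x \<subseteq> cell m x"
  by (induction n rule: dec_induct) (use cell_Suc in blast)+

text \<open>Two nodes of one level that share a point therefore coincide; this is how nodes are
  identified throughout.\<close>

lemma node_eqI: "\<lbrakk>p \<in> nodes; x \<in> snd p\<rbrakk> \<Longrightarrow> p = (fst p, cell (fst p) x)"
  unfolding nodes_def using cell_eq by fastforce

lemma node_nonempty: "p \<in> nodes \<Longrightarrow> snd p \<noteq> {}"
  unfolding nodes_def using mem_cell by fastforce

text \<open>The feature that general covers lack: overlapping nodes are comparable, so a cover can
  be thinned to its maximal members.\<close>

lemma nodes_nested:
  assumes "p \<in> nodes" "q \<in> nodes" "x \<in> snd p" "x \<in> snd q" "fst p \<le> fst q"
  shows "snd q \<subseteq> snd p"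
  using node_eqI[OF assms(1,3)] node_eqI[OF assms(2,4)] cell_antimono[OF assms(5), of x]
  by (metis snd_conv)

lemma cost_finite: "cost p < top"
  using w_antimono[of 0 "fst p"] w_finite by (simp add: cost_def order.strict_trans1)

lemma total_cost_mono: "N \<subseteq> N' \<Longrightarrow> total_cost N \<le> total_cost N'"
  unfolding total_cost_def by (rule emeasure_mono) auto

lemma total_cost_Un_disjoint: "N \<inter> N' = {} \<Longrightarrow> total_cost (N \<union> N') = total_cost N + total_cost N'"
  unfolding total_cost_def by (rule plus_emeasure[symmetric]) auto

lemma total_cost_finite_UN_disjoint:
  "\<lbrakk>finite I; disjoint_family_on N I\<rbrakk> \<Longrightarrow> (\<Sum>i\<in>I. total_cost (N i)) = total_cost (\<Union>i\<in>I. N i)"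
  unfolding total_cost_def by (rule sum_emeasure) auto

lemma cost_le_total_cost: "p \<in> N \<Longrightarrow> cost p \<le> total_cost N"
  using total_cost_mono[of "{p}" N] by (simp add: total_cost_def emeasure_weight_measure_finite)

lemma net_content_le: "\<lbrakk>N \<subseteq> nodes; E \<subseteq> (\<Union>p\<in>N. snd p)\<rbrakk> \<Longrightarrow> net_content E \<le> total_cost N"
  unfolding net_content_def by (rule INF_lower) simp

lemma net_content_less_cover:
  assumes "net_content E < c"
  obtains N where "N \<subseteq> nodes" "E \<subseteq> (\<Union>p\<in>N. snd p)" "total_cost N < c"
  using assms unfolding net_content_def INF_less_iff by blast

lemma net_content_mono: "E \<subseteq> F \<Longrightarrow> net_content E \<le> net_content F"
  unfolding net_content_def by (rule INF_superset_mono) auto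

lemma net_content_Int_node_le: "p \<in> nodes \<Longrightarrow> net_content (E \<inter> snd p) \<le> cost p"
  using net_content_le[of "{p}" "E \<inter> snd p"]
  by (simp add: total_cost_def emeasure_weight_measure_finite)

lemma net_content_cell_le: "net_content (cell n x) \<le> w n"
  using net_content_Int_node_le[of "(n, cell n x)" UNIV] by (auto simp: nodes_def cost_def)

lemma net_content_le_root: "net_content E \<le> w 0"
  using net_content_cell_le[of 0] net_content_mono[of E UNIV] by (metis cell_0 order_trans subset_UNIV)

text \<open>The root covers every set at finite cost; this makes near optimal covers and
  cancellation available.\<close>

lemma net_content_finite: "net_content E < top"
  using net_content_le_root w_finite by (rule order.strict_trans1)

lemma net_content_near_cover:
  assumes "0 < e"
  obtains N where "N \<subseteq> nodes" "E \<subseteq> (\<Union>p\<in>N. snd p)" "total_cost N \<le> net_content E + ennreal e"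
proof -
  have "net_content E < net_content E + ennreal e"
    using net_content_finite[of E] assms ennreal_add_left_cancel_less[of "net_content E" 0] by simp
  then show ?thesis using net_content_less_cover that by (metis less_imp_le)
qed

lemma net_content_UN_le: "net_content (\<Union>i. A i) \<le> (\<Sum>i. net_content (A i))"
proof (rule ennreal_le_epsilon)
  fix e :: real assume "0 < e"
  have "\<exists>N. N \<subseteq> nodes \<and> A i \<subseteq> (\<Union>p\<in>N. snd p) \<and> total_cost N \<le> net_content (A i) + ennreal (e * (1 / 2) ^ Suc i)" for i
  proof -
    have "0 < e * (1 / 2) ^ Suc i" using \<open>0 < e\<close> by simp
    then show ?thesis using net_content_near_cover[of "e * (1 / 2) ^ Suc i" "A i"] by metis
  qed
  then obtain N where N: "\<And>i. N i \<subseteq> nodes" "\<And>i. A i \<subseteq> (\<Union>p\<in>N i. snd p)"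
    "\<And>i. total_cost (N i) \<le> net_content (A i) + ennreal (e * (1 / 2) ^ Suc i)"
    by metis
  have "net_content (\<Union>i. A i) \<le> total_cost (\<Union>i. N i)"
    using N(1,2) by (intro net_content_le UN_least) (auto, blast)
  also have "\<dots> \<le> (\<Sum>i. total_cost (N i))"
    unfolding total_cost_def by (rule emeasure_subadditive_countably) auto
  also have "\<dots> \<le> (\<Sum>i. net_content (A i) + ennreal (e * (1 / 2) ^ Suc i))"
    by (intro suminf_le N(3)) auto
  finally show "net_content (\<Union>i. A i) \<le> (\<Sum>i. net_content (A i)) + ennreal e"
    using \<open>0 < e\<close> by (simp only: suminf_add_half_series less_imp_le)
qed

lemma net_content_empty [simp]: "net_content {} = 0"
  using net_content_le[of "{}" "{}"] by (simp add: total_cost_def)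

lemma net_content_Un_le: "net_content (A \<union> B) \<le> net_content A + net_content B"
proof -
  let ?A = "\<lambda>i::nat. if i = 0 then A else if i = 1 then B else {}"
  have "A \<union> B \<subseteq> (\<Union>i. ?A i)" by (auto split: if_splits)
  then have "net_content (A \<union> B) \<le> (\<Sum>i. net_content (?A i))"
    by (rule order_trans[OF net_content_mono net_content_UN_le])
  also have "\<dots> = (\<Sum>i\<in>{0, 1}. net_content (?A i))"
    by (rule suminf_finite) auto
  finally show ?thesis by simp
qed

lemma net_content_finite_UN_le:
  "finite I \<Longrightarrow> net_content (\<Union>i\<in>I. A i) \<le> (\<Sum>i\<in>I. net_content (A i))"
proof (induction I rule: finite_induct)
  case (insert i I)
  have "net_content (A i \<union> (\<Union>i\<in>I. A i)) \<le> net_content (A i) + net_content (\<Union>i\<in>I. A i)"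
    by (rule net_content_Un_le)
  also have "\<dots> \<le> net_content (A i) + (\<Sum>i\<in>I. net_content (A i))"
    using insert by (intro add_left_mono)
  finally show ?case using insert by simp
qed simp

section \<open>Additivity along children and continuity from below\<close>

lemma sum_total_cost_subnodes_le:
  assumes N: "N \<subseteq> nodes" and D: "finite D" "D \<subseteq> nodes" "\<And>q. q \<in> D \<Longrightarrow> fst q = n"
  shows "(\<Sum>q\<in>D. total_cost {p \<in> N. snd p \<subseteq> snd q}) \<le> total_cost N"
proof -
  \<comment> \<open>Nodes are nonempty, and a point determines its node of level \<open>n\<close>,
    so no node of \<open>N\<close> lies in two members of \<open>D\<close>.\<close>
  have "disjoint_family_on (\<lambda>q. {p \<in> N. snd p \<subseteq> snd q}) D"
    unfolding disjoint_family_on_def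
  proof (intro ballI impI, rule ccontr)
    fix q q' assume q: "q \<in> D" "q' \<in> D" "q \<noteq> q'"
      and "{p \<in> N. snd p \<subseteq> snd q} \<inter> {p \<in> N. snd p \<subseteq> snd q'} \<noteq> {}"
    then obtain p where p: "p \<in> N" "snd p \<subseteq> snd q" "snd p \<subseteq> snd q'" by blast
    with N node_nonempty obtain x where "x \<in> snd p" by blast
    then have "x \<in> snd q" "x \<in> snd q'" using p by auto
    then have "q = q'" using q D node_eqI by (metis subsetD)
    with q show False by simp
  qed
  then have "(\<Sum>q\<in>D. total_cost {p \<in> N. snd p \<subseteq> snd q}) = total_cost (\<Union>q\<in>D. {p \<in> N. snd p \<subseteq> snd q})"
    by (rule total_cost_finite_UN_disjoint[OF D(1)])
  also have "\<dots> \<le> total_cost N" by (rule total_cost_mono) blast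
  finally show ?thesis .
qed

text \<open>A cover cheaper than \<open>cost q\<close> has no node of level at most that of
  \<open>q\<close>, since weights do not increase with the level. Its nodes that meet a child of
  \<open>q\<close> lie inside that child, so the cover splits along the children. The strict
  inequality is essential: a saturated node may be cheaper than its children together.\<close>

lemma sum_net_content_children_le:
  assumes q: "q \<in> nodes" and less: "net_content (E \<inter> snd q) < cost q"
    and D: "finite D" "D \<subseteq> nodes" "\<And>p. p \<in> D \<Longrightarrow> fst p = Suc (fst q) \<and> snd p \<subseteq> snd q"
  shows "(\<Sum>p\<in>D. net_content (E \<inter> snd p)) \<le> net_content (E \<inter> snd q)"
proof (rule ennreal_le_epsilon)
  fix e :: real assume "0 < e"
  have "net_content (E \<inter> snd q) < net_content (E \<inter> snd q) + ennreal e"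
    using net_content_finite[of "E \<inter> snd q"] \<open>0 < e\<close> ennreal_add_left_cancel_less[of "net_content (E \<inter> snd q)" 0] by simp
  then have "net_content (E \<inter> snd q) < min (cost q) (net_content (E \<inter> snd q) + ennreal e)"
    using less by simp
  then obtain N where N: "N \<subseteq> nodes" "E \<inter> snd q \<subseteq> (\<Union>p\<in>N. snd p)"
    and t: "total_cost N < min (cost q) (net_content (E \<inter> snd q) + ennreal e)"
    by (rule net_content_less_cover)
  have level: "fst q < fst p" if "p \<in> N" for p
  proof (rule ccontr)
    assume "\<not> fst q < fst p"
    then have "cost q \<le> cost p" unfolding cost_def by (intro w_antimono) simp
    also have "\<dots> \<le> total_cost N" using that by (rule cost_le_total_cost)
    finally show False using t by (auto dest: leD)
  qed
  have "(\<Sum>p\<in>D. net_content (E \<inter> snd p)) \<le> (\<Sum>p\<in>D. total_cost {r \<in> N. snd r \<subseteq> snd p})"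
  proof (rule sum_mono, rule net_content_le)
    fix p assume p: "p \<in> D"
    show "E \<inter> snd p \<subseteq> (\<Union>r\<in>{r \<in> N. snd r \<subseteq> snd p}. snd r)"
    proof
      fix x assume x: "x \<in> E \<inter> snd p"
      then obtain r where r: "r \<in> N" "x \<in> snd r" using N(2) D(3)[OF p] by blast
      have "snd r \<subseteq> snd p"
        using level[OF r(1)] D(2) D(3)[OF p] p N(1) r x
        by (intro nodes_nested[of p r x]) auto
      then show "x \<in> (\<Union>r\<in>{r \<in> N. snd r \<subseteq> snd p}. snd r)" using r by blast
    qed
  qed (use N in auto)
  also have "\<dots> \<le> total_cost N" using N(1) D by (intro sum_total_cost_subnodes_le) auto
  also have "\<dots> \<le> net_content (E \<inter> snd q) + ennreal e" using t by (simp add: less_imp_le)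
  finally show "(\<Sum>p\<in>D. net_content (E \<inter> snd p)) \<le> net_content (E \<inter> snd q) + ennreal e" .
qed

text \<open>Grouping a finite antichain by children, level by level, so that additivity along children
  suffices.\<close>

lemma sum_antichain_le:
  fixes \<phi> :: "nat \<times> 'a set \<Rightarrow> ennreal"
  assumes children: "\<And>q D. \<lbrakk>q \<in> nodes; \<phi> q < cost q; finite D; D \<subseteq> nodes;
      \<And>p. p \<in> D \<Longrightarrow> fst p = Suc (fst q) \<and> snd p \<subseteq> snd q\<rbrakk> \<Longrightarrow> (\<Sum>p\<in>D. \<phi> p) \<le> \<phi> q"
  assumes "finite F" "F \<subseteq> nodes" "q \<in> nodes"
    "\<And>p. p \<in> F \<Longrightarrow> snd p \<subseteq> snd q \<and> fst q \<le> fst p \<and> fst p \<le> fst q + k"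
    and anti: "\<And>p p'. \<lbrakk>p \<in> F; p' \<in> F; p \<noteq> p'\<rbrakk> \<Longrightarrow> snd p \<inter> snd p' = {}"
    and unstopped: "\<And>p r. \<lbrakk>p \<in> F; r \<in> nodes; fst r < fst p; snd p \<subseteq> snd r\<rbrakk> \<Longrightarrow> \<phi> r < cost r"
  shows "(\<Sum>p\<in>F. \<phi> p) \<le> \<phi> q"
  using assms(2-)
proof (induction k arbitrary: q F)
  case 0
  have "F \<subseteq> {q}"
  proof
    fix p assume p: "p \<in> F"
    obtain x where "x \<in> snd p" using 0 p node_nonempty by blast
    then have "p = q" using 0(4)[OF p] 0(2,3) p node_eqI by (metis add_0_right le_antisym subsetD)
    then show "p \<in> {q}" by simp
  qed
  then consider "F = {}" | "F = {q}" by blast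
  then show ?case by cases auto
next
  case (Suc k)
  show ?case
  proof (cases "q \<in> F")
    case True
    have "p = q" if "p \<in> F" for p
    proof (rule ccontr)
      assume "p \<noteq> q"
      then have "snd p \<inter> snd q = {}" using Suc.prems(5)[OF that True] by simp
      moreover have "snd p \<subseteq> snd q" using Suc.prems(4)[OF that] by simp
      moreover have "snd p \<noteq> {}" using node_nonempty Suc.prems(2) that by blast
      ultimately show False by blast
    qed
    then have "F = {q}" using True by blast
    then show ?thesis by simp
  next
    case False
    show ?thesis
    proof (cases "F = {}")
      case nonempty: False
      have "\<exists>x. x \<in> snd p" if "p \<in> F" for p
        using node_nonempty Suc.prems(2) that by blast
      then obtain pt where pt: "\<And>p. p \<in> F \<Longrightarrow> pt p \<in> snd p" by metis
      have level: "fst q < fst p" if "p \<in> F" for p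
      proof (rule ccontr)
        assume "\<not> fst q < fst p"
        then have "fst p = fst q" using Suc.prems(4)[OF that] by simp
        moreover have "pt p \<in> snd q" using pt[OF that] Suc.prems(4)[OF that] by blast
        ultimately have "p = q"
          using node_eqI[of p "pt p"] node_eqI[of q "pt p"] pt[OF that] Suc.prems(2,3) that by (metis subsetD)
        with False that show False by simp
      qed
      \<comment> \<open>The child of \<open>q\<close> that contains \<open>p\<close>; the members of
        \<open>F\<close> inside one child have levels at most \<open>k\<close> beyond it.\<close>
      define g where "g p = (Suc (fst q), cell (Suc (fst q)) (pt p))" for p
      have g_node: "g p \<in> nodes" for p unfolding g_def nodes_def by blast
      have sub_g: "snd p \<subseteq> snd (g p)" if "p \<in> F" for p
        using nodes_nested[OF g_node, of p "pt p" p] that pt[OF that] level[OF that] mem_cell Suc.prems(2)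
        by (auto simp: g_def Suc_le_eq)
      have g_sub: "snd (g p) \<subseteq> snd q" if "p \<in> F" for p
        using nodes_nested[OF Suc.prems(3) g_node, of "pt p" p] that pt[OF that] mem_cell Suc.prems(4)[OF that]
        by (auto simp: g_def)
      \<comment> \<open>\<open>q\<close> lies strictly above a member of \<open>F\<close>, so it is
        unstopped and \<open>children\<close> applies.\<close>
      have "\<phi> q < cost q"
        using nonempty Suc.prems(3,4,6) level by blast
      then have "(\<Sum>r\<in>g ` F. \<phi> r) \<le> \<phi> q"

      proof (rule children[OF Suc.prems(3)])
        show "finite (g ` F)" "g ` F \<subseteq> nodes" using Suc.prems(1) g_node by auto
        fix r assume "r \<in> g ` F"
        then obtain p where "r = g p" "p \<in> F" by blast
        then show "fst r = Suc (fst q) \<and> snd r \<subseteq> snd q"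
          using g_sub[of p] by (simp add: g_def)
      qed
      moreover have "(\<Sum>p\<in>F. \<phi> p) = (\<Sum>r\<in>g ` F. \<Sum>p\<in>{p \<in> F. g p = r}. \<phi> p)"
        by (rule sum.image_gen[OF Suc.prems(1)])
      moreover have "(\<Sum>p\<in>{p \<in> F. g p = r}. \<phi> p) \<le> \<phi> r" if "r \<in> g ` F" for r
      proof (rule Suc.IH)
        fix p assume p: "p \<in> {p \<in> F. g p = r}"
        then have r: "r = g p" "p \<in> F" by auto
        show "snd p \<subseteq> snd r \<and> fst r \<le> fst p \<and> fst p \<le> fst r + k"
          using sub_g[OF r(2)] level[OF r(2)] Suc.prems(4)[OF r(2)] unfolding r(1) by (auto simp: g_def)
      qed (use Suc.prems that g_node in \<open>auto\<close>)
      ultimately show ?thesis by (metis (no_types, lifting) order_trans sum_mono)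
    qed simp
  qed
qed

text \<open>Trading the nodes of \<open>G\<close> for efficient covers of \<open>E\<close> inside
  them gives another cover of \<open>E\<close>, and a near optimal \<open>N\<close> can gain at most
  \<open>e\<close> from this. Cancelling the finite cost of \<open>N - G\<close> yields the
  bound.\<close>

lemma sum_cost_near_cover_le:
  assumes N: "N \<subseteq> nodes" "E \<subseteq> (\<Union>p\<in>N. snd p)" "total_cost N \<le> net_content E + ennreal e"
    and G: "finite G" "G \<subseteq> N" and \<phi>: "\<And>p. p \<in> G \<Longrightarrow> net_content (E \<inter> snd p) \<le> \<phi> p"
  shows "(\<Sum>p\<in>G. cost p) \<le> (\<Sum>p\<in>G. \<phi> p) + ennreal e"
proof -
  let ?R = "total_cost (N - G)"
  have "total_cost N < top"
    using N(3) net_content_finite[of E] by (simp add: order.strict_trans1 ennreal_add_less_top)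
  then have fin: "?R < top" using total_cost_mono[of "N - G" N] by (simp add: order.strict_trans1)
  have "E \<subseteq> (\<Union>p\<in>G. E \<inter> snd p) \<union> (\<Union>p\<in>N - G. snd p)" using N(2) by blast
  then have "net_content E \<le> net_content (\<Union>p\<in>G. E \<inter> snd p) + net_content (\<Union>p\<in>N - G. snd p)"
    by (rule order_trans[OF net_content_mono net_content_Un_le])
  also have "\<dots> \<le> (\<Sum>p\<in>G. net_content (E \<inter> snd p)) + ?R"
    using N(1) G(1) by (intro add_mono net_content_finite_UN_le net_content_le) auto
  also have "\<dots> \<le> (\<Sum>p\<in>G. \<phi> p) + ?R" by (intro add_right_mono sum_mono \<phi>)
  finally have le: "net_content E \<le> (\<Sum>p\<in>G. \<phi> p) + ?R" .
  have "?R + (\<Sum>p\<in>G. cost p) = total_cost ((N - G) \<union> G)"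
    using G(1) by (subst total_cost_Un_disjoint)
      (auto simp: total_cost_def emeasure_weight_measure_finite)
  also have "(N - G) \<union> G = N" using G(2) by blast
  also have "total_cost N \<le> ((\<Sum>p\<in>G. \<phi> p) + ?R) + ennreal e"
    using N(3) le by (meson add_right_mono order_trans)
  also have "\<dots> = ?R + ((\<Sum>p\<in>G. \<phi> p) + ennreal e)" by (simp add: ac_simps)
  finally show ?thesis using fin by (auto simp: ennreal_add_left_cancel_le)
qed

text \<open>Each positive excess is charged to some \<open>N i\<close>; reading \<open>x\<close> as
  the weights of a measure turns this into countable subadditivity.\<close>

lemma sum_excess_le:
  assumes "finite F" "0 \<le> e" and cover: "\<And>p. \<lbrakk>p \<in> F; x p \<noteq> 0\<rbrakk> \<Longrightarrow> \<exists>i. p \<in> N i"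
    and le: "\<And>i::nat. (\<Sum>p\<in>F \<inter> N i. x p) \<le> ennreal (e * (1 / 2) ^ Suc i)"
  shows "(\<Sum>p\<in>F. x p) \<le> ennreal e"
proof -
  let ?M = "weight_measure x"
  have "(\<Sum>p\<in>F. x p) = (\<Sum>p\<in>{p \<in> F. x p \<noteq> 0}. x p)"
    using assms(1) by (intro sum.mono_neutral_right) auto
  also have "\<dots> = emeasure ?M {p \<in> F. x p \<noteq> 0}"
    using assms(1) by (simp add: emeasure_weight_measure_finite)
  also have "\<dots> \<le> emeasure ?M (\<Union>i. F \<inter> N i)"
    using cover by (intro emeasure_mono) auto
  also have "\<dots> \<le> (\<Sum>i. emeasure ?M (F \<inter> N i))"
    by (rule emeasure_subadditive_countably) auto
  also have "\<dots> \<le> (\<Sum>i. 0 + ennreal (e * (1 / 2) ^ Suc i))"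
    using assms(1) le by (intro suminf_le) (auto simp: emeasure_weight_measure_finite)
  also have "\<dots> = ennreal e"
    using suminf_add_half_series[OF assms(2), of "\<lambda>_. 0"] by (simp only: suminf_zero add_0_left)
  finally show ?thesis .
qed

text \<open>Nodes where \<open>\<phi>\<close> attains the cost are used as they are. Together with near optimal covers of
  all \<open>E i\<close> they cover the union, and only the maximal nodes are kept: above these \<open>\<phi>\<close> is
  additive, so their cost exceeds \<open>\<phi> (0, UNIV)\<close> by no more than the summed defects.\<close>

theorem net_content_UN_incseq:
  assumes "incseq E"
  shows "net_content (\<Union>i. E i) = (SUP i. net_content (E i))"
proof (rule antisym)
  show "(SUP i. net_content (E i)) \<le> net_content (\<Union>i. E i)"
    by (intro SUP_least net_content_mono) blast
  show "net_content (\<Union>i. E i) \<le> (SUP i. net_content (E i))"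
  proof (rule ennreal_le_epsilon)
    fix e :: real assume "0 < e"
    \<comment> \<open>The limit of the contents inside a node; at the root it is the supremum to be
      reached.\<close>
    define \<phi> where "\<phi> p = (SUP i. net_content (E i \<inter> snd p))" for p :: "nat \<times> 'a set"
    have \<phi>_ge: "net_content (E i \<inter> snd p) \<le> \<phi> p" for i p
      unfolding \<phi>_def by (rule SUP_upper) simp
    have \<phi>_le: "\<phi> p \<le> cost p" if "p \<in> nodes" for p
      unfolding \<phi>_def using that by (intro SUP_least net_content_Int_node_le)
    \<comment> \<open>\<open>\<phi> q < cost q\<close> leaves every \<open>E i\<close> unsaturated
      at \<open>q\<close>, so the estimate along children holds for each \<open>i\<close> and
      survives the monotone limit.\<close>
    have children: "(\<Sum>p\<in>D. \<phi> p) \<le> \<phi> q"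
      if "q \<in> nodes" "\<phi> q < cost q" "finite D" "D \<subseteq> nodes"
        "\<And>p. p \<in> D \<Longrightarrow> fst p = Suc (fst q) \<and> snd p \<subseteq> snd q" for q D
    proof -
      have "(\<Sum>p\<in>D. \<phi> p) = (SUP i. \<Sum>p\<in>D. net_content (E i \<inter> snd p))"
        unfolding \<phi>_def using assms
        by (intro ennreal_SUP_sum[symmetric] monoI net_content_mono) (auto simp: incseq_def)
      also have "\<dots> \<le> \<phi> q"
      proof (rule SUP_least)
        fix i
        have "net_content (E i \<inter> snd q) < cost q"
          using \<phi>_ge that(2) by (rule order.strict_trans1)
        then have "(\<Sum>p\<in>D. net_content (E i \<inter> snd p)) \<le> net_content (E i \<inter> snd q)"
          using that by (intro sum_net_content_children_le)
        also have "\<dots> \<le> \<phi> q" by (rule \<phi>_ge)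
        finally show "(\<Sum>p\<in>D. net_content (E i \<inter> snd p)) \<le> \<phi> q" .
      qed
      finally show ?thesis .
    qed
    have "\<exists>N. N \<subseteq> nodes \<and> E i \<subseteq> (\<Union>p\<in>N. snd p) \<and>
        total_cost N \<le> net_content (E i) + ennreal (e * (1 / 2) ^ Suc i)" for i
    proof -
      have "0 < e * (1 / 2) ^ Suc i" using \<open>0 < e\<close> by simp
      then show ?thesis using net_content_near_cover[of "e * (1 / 2) ^ Suc i" "E i"] by metis
    qed
    then obtain N where N: "\<And>i. N i \<subseteq> nodes" "\<And>i. E i \<subseteq> (\<Union>p\<in>N i. snd p)"
      "\<And>i. total_cost (N i) \<le> net_content (E i) + ennreal (e * (1 / 2) ^ Suc i)"
      by metis
    define S where "S = {p \<in> nodes. cost p \<le> \<phi> p}"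
    define A where "A = S \<union> (\<Union>i. N i)"
    define Q where "Q = {p \<in> A. \<forall>r\<in>A. fst r < fst p \<longrightarrow> \<not> snd p \<subseteq> snd r}"
    have A_nodes: "A \<subseteq> nodes" using N(1) unfolding A_def S_def by blast
    then have Q_nodes: "Q \<subseteq> nodes" unfolding Q_def by blast
    have "(\<Union>i. E i) \<subseteq> (\<Union>p\<in>Q. snd p)"
    proof
      fix x assume "x \<in> (\<Union>i. E i)"
      then obtain p0 where "p0 \<in> A \<and> x \<in> snd p0" using N(2) unfolding A_def by blast
      then obtain p where p: "p \<in> A \<and> x \<in> snd p" "\<And>r. r \<in> A \<and> x \<in> snd r \<Longrightarrow> fst p \<le> fst r"
        using ex_has_least_nat[of "\<lambda>p. p \<in> A \<and> x \<in> snd p" p0 fst] by blast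
      have "p \<in> Q" unfolding Q_def using p by (auto simp: not_le[symmetric])
      with p show "x \<in> (\<Union>p\<in>Q. snd p)" by blast
    qed
    then have "net_content (\<Union>i. E i) \<le> total_cost Q" using Q_nodes by (intro net_content_le)
    also have "\<dots> \<le> (SUP i. net_content (E i)) + ennreal e"
      unfolding total_cost_def
    proof (rule emeasure_weight_measure_le)
      \<comment> \<open>Finite subfamilies suffice, and they have bounded levels, as the induction
        in \<open>sum_antichain_le\<close> requires.\<close>
      fix F assume F: "finite F" "F \<subseteq> Q"
      have F_nodes: "F \<subseteq> nodes" using F Q_nodes by blast
      obtain k where k: "\<And>p. p \<in> F \<Longrightarrow> fst p \<le> k"
        using F(1) finite_nat_set_iff_bounded_le[of "fst ` F"] by auto
      have "(\<Sum>p\<in>F. \<phi> p) \<le> \<phi> (0, UNIV)"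
      proof (rule sum_antichain_le[where \<phi> = \<phi> and k = k, OF children F(1) F_nodes])
        show "(0, UNIV) \<in> nodes" unfolding nodes_def using cell_0 by auto
        fix p assume p: "p \<in> F"
        then show "snd p \<subseteq> snd (0, UNIV) \<and> fst (0, UNIV :: 'a set) \<le> fst p \<and> fst p \<le> fst (0, UNIV :: 'a set) + k"
          using k by simp
        {
          fix p' assume p': "p' \<in> F" "p \<noteq> p'"
          show "snd p \<inter> snd p' = {}"
          proof (rule ccontr)
            assume "snd p \<inter> snd p' \<noteq> {}"
            then obtain x where x: "x \<in> snd p" "x \<in> snd p'" by blast
            have pQ: "p \<in> Q" "p' \<in> Q" "p \<in> nodes" "p' \<in> nodes" using p p' F F_nodes by auto
            have "fst p \<noteq> fst p'"
              using node_eqI[of p x] node_eqI[of p' x] x pQ p' by metis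
            then consider "fst p < fst p'" | "fst p' < fst p" by linarith
            then show False
            proof cases
              case 1
              with nodes_nested[of p p' x] x pQ show False unfolding Q_def by auto
            next
              case 2
              with nodes_nested[of p' p x] x pQ show False unfolding Q_def by auto
            qed
          qed
        }
        {
          fix r assume r: "r \<in> nodes" "fst r < fst p" "snd p \<subseteq> snd r"
          \<comment> \<open>Maximality of \<open>p\<close> excludes every strictly coarser node of
            \<open>A\<close> above it.\<close>
          then have "r \<notin> S" using p F unfolding Q_def A_def by blast
          then show "\<phi> r < cost r" using r(1) unfolding S_def by (simp add: not_le)
        }
      qed
      then have \<phi>_sum: "(\<Sum>p\<in>F. \<phi> p) \<le> (SUP i. net_content (E i))" by (simp add: \<phi>_def)
      have split: "cost p = \<phi> p + (cost p - \<phi> p)" if "p \<in> nodes" for p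
        using \<phi>_le[OF that] by (simp add: add_diff_inverse_ennreal)
      have sum_split: "(\<Sum>p\<in>G. cost p) = (\<Sum>p\<in>G. \<phi> p) + (\<Sum>p\<in>G. cost p - \<phi> p)" if "G \<subseteq> nodes" for G
      proof -
        have "(\<Sum>p\<in>G. cost p) = (\<Sum>p\<in>G. \<phi> p + (cost p - \<phi> p))"
          by (rule sum.cong[OF refl split]) (use that in blast)
        then show ?thesis by (simp only: sum.distrib)
      qed
      have "(\<Sum>p\<in>F. cost p - \<phi> p) \<le> ennreal e"
      proof (rule sum_excess_le[where N = N])
        fix p assume p: "p \<in> F" "cost p - \<phi> p \<noteq> 0"
        then have "\<not> cost p \<le> \<phi> p"
          using cost_finite[of p] by (auto simp: ennreal_minus_eq_0 diff_eq_0_iff_ennreal)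
        \<comment> \<open>Stopped nodes have no excess, so a node with excess came from a near
          optimal cover.\<close>
        then have "p \<notin> S" unfolding S_def by blast
        with p F show "\<exists>i. p \<in> N i" unfolding Q_def A_def by blast
      next
        fix i
        let ?G = "F \<inter> N i"
        have "(\<Sum>p\<in>?G. \<phi> p) + (\<Sum>p\<in>?G. cost p - \<phi> p) = (\<Sum>p\<in>?G. cost p)"
          using F_nodes by (intro sum_split[symmetric]) blast
        also have "\<dots> \<le> (\<Sum>p\<in>?G. \<phi> p) + ennreal (e * (1 / 2) ^ Suc i)"
          using F(1) \<phi>_ge by (intro sum_cost_near_cover_le[OF N]) auto
        finally have "(\<Sum>p\<in>?G. \<phi> p) + (\<Sum>p\<in>?G. cost p - \<phi> p)
          \<le> (\<Sum>p\<in>?G. \<phi> p) + ennreal (e * (1 / 2) ^ Suc i)" .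
        moreover have "(\<Sum>p\<in>?G. \<phi> p) \<noteq> top"
        proof -
          have "\<phi> p < top" if "p \<in> ?G" for p
            using \<phi>_le[of p] cost_finite[of p] that F_nodes by (auto intro: order.strict_trans1)
          then have "(\<Sum>p\<in>?G. \<phi> p) < top" using F(1) by (subst ennreal_sum_less_top) auto
          then show ?thesis by simp
        qed
        ultimately show "(\<Sum>p\<in>?G. cost p - \<phi> p) \<le> ennreal (e * (1 / 2) ^ Suc i)"
          by (simp add: ennreal_add_left_cancel_le)
      qed (use F \<open>0 < e\<close> in auto)
      moreover have "(\<Sum>p\<in>F. cost p) = (\<Sum>p\<in>F. \<phi> p) + (\<Sum>p\<in>F. cost p - \<phi> p)"
        using F_nodes by (rule sum_split)
      ultimately show "(\<Sum>p\<in>F. cost p) \<le> (SUP i. net_content (E i)) + ennreal e"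
        using \<phi>_sum by (simp add: add_mono)
    qed
    finally show "net_content (\<Union>i. E i) \<le> (SUP i. net_content (E i)) + ennreal e" .
  qed
qed

end

section \<open>Dyadic net content\<close>

text \<open>Level 0 is an artificial root joining all unit cubes into one tree; level
  \<open>Suc n\<close> consists of half-open cubes of side \<open>1 / 2 ^ n\<close>, hence the index
  shift.\<close>

primrec dyadic_cell :: "nat \<Rightarrow> 'a::euclidean_space \<Rightarrow> 'a set" where
  "dyadic_cell 0 x = UNIV"
| "dyadic_cell (Suc n) x = {y. \<forall>b\<in>Basis. \<lfloor>2 ^ n * (y \<bullet> b)\<rfloor> = \<lfloor>2 ^ n * (x \<bullet> b)\<rfloor>}"

text \<open>The side length to the power \<open>s\<close>, with the root priced like a unit cube.
  This keeps all contents finite, while covers of cost below 1 cannot use the root, so it does not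
  affect null sets.\<close>

primrec dyadic_weight :: "real \<Rightarrow> nat \<Rightarrow> ennreal" where
  "dyadic_weight s 0 = 1"
| "dyadic_weight s (Suc n) = ennreal ((1 / 2 ^ n) powr s)"

abbreviation dyadic_content :: "real \<Rightarrow> 'a::euclidean_space set \<Rightarrow> ennreal" where
  "dyadic_content s \<equiv> nested_partitions.net_content dyadic_cell (dyadic_weight s)"

lemma nested_partitions_dyadic:
  assumes "0 < s"
  shows "nested_partitions (dyadic_cell :: nat \<Rightarrow> 'a::euclidean_space \<Rightarrow> 'a set) (dyadic_weight s)"
proof
  fix x y :: 'a and m n :: nat
  show "x \<in> dyadic_cell n x" by (cases n) auto
  show "y \<in> dyadic_cell n x \<Longrightarrow> dyadic_cell n y = dyadic_cell n x" by (cases n) auto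
  show "dyadic_cell (Suc n) x \<subseteq> dyadic_cell n x"
  proof (cases n)
    case (Suc k)
    \<comment> \<open>The index of a cube determines that of its parent by integer halving.\<close>
    have half: "\<lfloor>2 ^ k * t\<rfloor> = \<lfloor>2 ^ Suc k * t\<rfloor> div 2" for t :: real
      using floor_divide_real_eq_div[of 2 "2 ^ Suc k * t"] by simp
    show ?thesis unfolding Suc dyadic_cell.simps half by (intro Collect_mono) metis
  qed simp
  show "dyadic_cell 0 x = UNIV" by simp
  have le: "dyadic_weight s (Suc n) \<le> dyadic_weight s n" for n
  proof (cases n)
    case 0
    then show ?thesis by simp
  next
    case (Suc k)
    have "(1 / 2 ^ Suc k) powr s \<le> (1 / 2 ^ k :: real) powr s"
      using assms by (intro powr_mono2) (auto simp: field_simps)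
    then show ?thesis unfolding Suc dyadic_weight.simps by (rule ennreal_leI)
  qed
  show "dyadic_weight s n \<le> dyadic_weight s m" if "m \<le> n"
    using lift_Suc_antimono_le[of "dyadic_weight s", OF le that] .
  show "dyadic_weight s 0 < top" by simp
qed

section \<open>Comparison of dyadic and Hausdorff content\<close>

lemma diam_power_dyadic_cell_le:
  fixes x :: "'a::euclidean_space"
  assumes "0 < s"
  shows "diam_power s (dyadic_cell (Suc n) x) \<le> ennreal (DIM('a) powr s) * dyadic_weight s (Suc n)"
proof -
  \<comment> \<open>Bounding the Euclidean norm by the 1-norm gives \<open>DIM('a)\<close> times the
    side, precise enough for comparing null sets.\<close>
  let ?d = "real DIM('a) * (1 / 2 ^ n)"
  have le: "norm (y - z) \<le> ?d" if "y \<in> dyadic_cell (Suc n) x" "z \<in> dyadic_cell (Suc n) x" for y z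
  proof -
    have "norm (y - z) \<le> (\<Sum>b\<in>Basis. \<bar>(y - z) \<bullet> b\<bar>)" by (rule norm_le_l1)
    also have "\<dots> \<le> (\<Sum>b\<in>(Basis :: 'a set). 1 / 2 ^ n)"
    proof (rule sum_mono)
      fix b :: 'a assume "b \<in> Basis"
      then have "\<lfloor>2 ^ n * (y \<bullet> b)\<rfloor> = \<lfloor>2 ^ n * (z \<bullet> b)\<rfloor>" using that by simp
      then have "\<bar>2 ^ n * (y \<bullet> b) - 2 ^ n * (z \<bullet> b)\<bar> \<le> 1" by linarith
      then have "2 ^ n * \<bar>(y - z) \<bullet> b\<bar> \<le> 1"
        by (simp add: inner_diff_left abs_mult flip: right_diff_distrib)
      then show "\<bar>(y - z) \<bullet> b\<bar> \<le> 1 / 2 ^ n" by (simp add: field_simps)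
    qed
    finally show ?thesis by simp
  qed
  have "bounded (dyadic_cell (Suc n) x)"
    unfolding bounded_two_points using le by (metis dist_norm)
  moreover have "diameter (dyadic_cell (Suc n) x) \<le> ?d"
    using le by (intro diameter_le) auto
  ultimately have "diam_power s (dyadic_cell (Suc n) x) \<le> ennreal (?d powr s)"
    by (intro diam_power_le assms)
  also have "?d powr s = DIM('a) powr s * (1 / 2 ^ n) powr s" by (rule powr_mult)
  also have "ennreal \<dots> = ennreal (DIM('a) powr s) * dyadic_weight s (Suc n)"
    by (simp add: ennreal_mult)
  finally show ?thesis .
qed

text \<open>The predecessor of the first power of \<open>1 / 2\<close> below \<open>d\<close>; it
  exists because \<open>d \<le> 1\<close> rules out the exponent 0.\<close>

lemma dyadic_scale:
  assumes "0 < d" "d \<le> (1::real)"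
  obtains n where "d \<le> 1 / 2 ^ n" "1 / 2 ^ n < 2 * d"
proof -
  define m where "m = (LEAST m. (1 / 2) ^ m < d)"
  have "\<exists>m. (1 / 2) ^ m < d" using assms by (intro real_arch_pow_inv) auto
  then have m: "(1 / 2) ^ m < d" unfolding m_def by (rule LeastI_ex)
  then obtain n where n: "m = Suc n" using assms by (cases m) auto
  have "\<not> (1 / 2) ^ n < d" using not_less_Least[of n "\<lambda>m. (1 / 2) ^ m < d"] n by (simp add: m_def)
  with m n show ?thesis by (intro that[of n]) (auto simp: power_divide)
qed

text \<open>Each coordinate of \<open>2 ^ n * y\<close> stays within 1 of that of a fixed
  \<open>z\<close> in \<open>U\<close>, scaled likewise, so its floor takes at most three values.
  Hence \<open>U\<close> meets at most \<open>3 ^ DIM('a)\<close> cubes of side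
  \<open>1 / 2 ^ n\<close>.\<close>

lemma dyadic_content_small_set_le:
  fixes U :: "'a::euclidean_space set"
  assumes "0 < s" "\<And>y z. \<lbrakk>y \<in> U; z \<in> U\<rbrakk> \<Longrightarrow> dist y z \<le> 1 / 2 ^ n"
  shows "dyadic_content s U \<le> ennreal (3 ^ DIM('a) * (1 / 2 ^ n) powr s)"
proof (cases "U = {}")
  interpret nested_partitions "dyadic_cell :: nat \<Rightarrow> 'a \<Rightarrow> 'a set" "dyadic_weight s"
    using assms(1) by (rule nested_partitions_dyadic)
  case True
  then show ?thesis by simp
next
  interpret nested_partitions "dyadic_cell :: nat \<Rightarrow> 'a \<Rightarrow> 'a set" "dyadic_weight s"
    using assms(1) by (rule nested_partitions_dyadic)
  case False
  then obtain z where z: "z \<in> U" by blast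
  define code where "code y = restrict (\<lambda>b. \<lfloor>2 ^ n * (y \<bullet> b)\<rfloor>) Basis" for y :: 'a
  define P where "P = (\<Pi>\<^sub>E b\<in>(Basis :: 'a set). {\<lfloor>2 ^ n * (z \<bullet> b)\<rfloor> - 1..\<lfloor>2 ^ n * (z \<bullet> b)\<rfloor> + 1})"
  \<comment> \<open>Indexing the cubes by integer vectors transfers the cardinality bound of
    \<open>P\<close> to \<open>N\<close>.\<close>
  define N where "N = (\<lambda>k. (Suc n, {y :: 'a. \<forall>b\<in>Basis. \<lfloor>2 ^ n * (y \<bullet> b)\<rfloor> = k b})) ` (code ` U)"
  have N_eq: "N = (\<lambda>y. (Suc n, dyadic_cell (Suc n) y)) ` U"
    unfolding N_def image_image by (intro image_cong) (auto simp: code_def)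
  have "code y \<in> P" if "y \<in> U" for y
  proof -
    have "\<bar>2 ^ n * (y \<bullet> b) - 2 ^ n * (z \<bullet> b)\<bar> \<le> 1" if "b \<in> Basis" for b
    proof -
      have "\<bar>(y - z) \<bullet> b\<bar> \<le> 1 / 2 ^ n"
        using Basis_le_norm[OF that, of "y - z"] assms(2)[OF \<open>y \<in> U\<close> z] by (simp add: dist_norm)
      then have "2 ^ n * \<bar>(y - z) \<bullet> b\<bar> \<le> 1" by (simp add: field_simps)
      then show ?thesis by (simp add: inner_diff_left abs_mult flip: right_diff_distrib)
    qed
    then have "\<lfloor>2 ^ n * (y \<bullet> b)\<rfloor> \<in> {\<lfloor>2 ^ n * (z \<bullet> b)\<rfloor> - 1..\<lfloor>2 ^ n * (z \<bullet> b)\<rfloor> + 1}" if "b \<in> Basis" for b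
      using that unfolding atLeastAtMost_iff by (smt (verit) floor_add_int floor_mono le_floor_iff of_int_1)
    then show ?thesis unfolding P_def code_def by simp
  qed
  then have "code ` U \<subseteq> P" by blast
  moreover have "finite P" unfolding P_def by (intro finite_PiE) auto
  ultimately have "finite (code ` U)" "card (code ` U) \<le> card P"
    by (auto intro: finite_subset card_mono)
  moreover have "card P = 3 ^ DIM('a)" unfolding P_def by (simp add: card_PiE)
  ultimately have "finite N" "card N \<le> 3 ^ DIM('a)"
    unfolding N_def by (auto intro: order_trans[OF card_image_le])
  note N = this
  have "dyadic_content s U \<le> total_cost N"
  proof (rule net_content_le)
    show "N \<subseteq> nodes" unfolding N_eq nodes_def by blast
    show "U \<subseteq> (\<Union>p\<in>N. snd p)" unfolding N_eq using mem_cell[of _ "Suc n"] by fastforce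
  qed
  also have "\<dots> = (\<Sum>p\<in>N. cost p)"
    using N by (simp add: total_cost_def emeasure_weight_measure_finite)
  also have "\<dots> = (\<Sum>p\<in>N. ennreal ((1 / 2 ^ n) powr s))"
    by (intro sum.cong) (auto simp: N_def cost_def)
  also have "\<dots> = ennreal (real (card N) * (1 / 2 ^ n) powr s)"
    by (simp add: ennreal_mult ennreal_of_nat_eq_real_of_nat)
  also have "\<dots> \<le> ennreal (3 ^ DIM('a) * (1 / 2 ^ n) powr s)"
  proof (intro ennreal_leI mult_right_mono)
    show "real (card N) \<le> 3 ^ DIM('a)" using N(2) by (metis of_nat_le_iff of_nat_numeral of_nat_power)
  qed simp
  finally show ?thesis .
qed

text \<open>\<open>3 ^ DIM('a)\<close> counts neighbouring cubes and \<open>2 powr s\<close> pays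
  for rounding the diameter up to a power of 2. Openness gives a nonempty \<open>U\<close> positive
  diameter, so a scale exists; sets of diameter above 1 are covered by the root.\<close>

lemma dyadic_content_open_le:
  fixes U :: "'a::euclidean_space set"
  assumes "0 < s" "open U"
  shows "dyadic_content s U \<le> ennreal (3 ^ DIM('a) * 2 powr s) * diam_power s U"
proof -
  interpret nested_partitions "dyadic_cell :: nat \<Rightarrow> 'a \<Rightarrow> 'a set" "dyadic_weight s"
    using assms(1) by (rule nested_partitions_dyadic)
  let ?C = "3 ^ DIM('a) * 2 powr s :: real"
  have "1 * 1 \<le> ?C" using assms by (intro mult_mono) (auto intro: ge_one_powr_ge_zero)
  then have C: "1 \<le> ?C" by simp
  consider "U = {}" | "\<not> bounded U" | "U \<noteq> {}" "bounded U" "1 < diameter U"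
    | "U \<noteq> {}" "bounded U" "diameter U \<le> 1" by linarith
  then show ?thesis
  proof cases
    case 1
    then show ?thesis by simp
  next
    case 2
    then have "diam_power s U = top" using assms by (auto simp: diam_power_def)
    then show ?thesis using C by (simp add: ennreal_mult_top)
  next
    case 3
    have "dyadic_content s U \<le> 1" using net_content_le_root[of U] by simp
    also have "\<dots> = ennreal (1 * 1)" by simp
    also have "\<dots> \<le> ennreal (?C * diameter U powr s)"
      using 3 C assms by (intro ennreal_leI mult_mono ge_one_powr_ge_zero) auto
    also have "\<dots> = ennreal ?C * diam_power s U"
      using 3 C assms by (simp add: diam_power_def ennreal_mult)
    finally show ?thesis .
  next
    case 4
    obtain x r where r: "0 < r" "ball x r \<subseteq> U" using 4 assms by (meson openE ex_in_conv)
    then have "2 * r \<le> diameter U" using diameter_subset[OF r(2) 4(2)] by simp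
    then have pos: "0 < diameter U" using r by simp
    then obtain n where n: "diameter U \<le> 1 / 2 ^ n" "1 / 2 ^ n < 2 * diameter U"
      using dyadic_scale 4 by blast
    have "dyadic_content s U \<le> ennreal (3 ^ DIM('a) * (1 / 2 ^ n) powr s)"
      using diameter_bounded_bound[OF 4(2)] n(1)
      by (intro dyadic_content_small_set_le assms) (auto intro: order_trans)
    also have "\<dots> \<le> ennreal (3 ^ DIM('a) * (2 * diameter U) powr s)"
      using n assms by (intro ennreal_leI mult_left_mono powr_mono2) auto
    also have "\<dots> = ennreal (?C * diameter U powr s)"
      using pos by (simp add: powr_mult mult.assoc)
    also have "\<dots> = ennreal ?C * diam_power s U"
      using 4 C assms by (simp add: diam_power_def ennreal_mult)
    finally show ?thesis .
  qed
qed

lemma dyadic_content_less: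
  fixes E :: "'a::euclidean_space set"
  assumes "0 < s" "Hausdorff_content s E < e"
  shows "dyadic_content s E < ennreal (3 ^ DIM('a) * 2 powr s) * e"
proof -
  interpret nested_partitions "dyadic_cell :: nat \<Rightarrow> 'a \<Rightarrow> 'a set" "dyadic_weight s"
    using assms(1) by (rule nested_partitions_dyadic)
  let ?C = "ennreal (3 ^ DIM('a) * 2 powr s)"
  obtain U where U: "E \<subseteq> (\<Union>i. U i)" "\<And>i. open (U i)" "(\<Sum>i. diam_power s (U i)) < e"
    using Hausdorff_content_less_cover[OF assms(2)] by metis
  have "dyadic_content s E \<le> (\<Sum>i. dyadic_content s (U i))"
    using U(1) by (rule order_trans[OF net_content_mono net_content_UN_le])
  also have "\<dots> \<le> (\<Sum>i. ?C * diam_power s (U i))"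
    using U(2) assms by (intro suminf_le dyadic_content_open_le) auto
  also have "\<dots> = ?C * (\<Sum>i. diam_power s (U i))" by simp
  also have "\<dots> < ?C * e" using U(3) by (intro ennreal_mult_strict_left_mono) auto
  finally show ?thesis .
qed

text \<open>Cubes are indexed by integer vectors; countability lets a cover by nodes be listed as
  the sequence that Hausdorff content requires.\<close>

lemma countable_range_dyadic_cell: "countable (range (dyadic_cell n :: 'a::euclidean_space \<Rightarrow> 'a set))"
proof (cases n)
  case 0
  have "range (dyadic_cell n :: 'a \<Rightarrow> 'a set) = {UNIV}" unfolding 0 by auto
  then show ?thesis by simp
next
  case (Suc k)
  have "range (dyadic_cell n :: 'a \<Rightarrow> 'a set) \<subseteq>
    (\<lambda>c. {y. \<forall>b\<in>Basis. \<lfloor>2 ^ k * (y \<bullet> b)\<rfloor> = c b}) ` (\<Pi>\<^sub>E b\<in>(Basis :: 'a set). (UNIV :: int set))"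
  proof
    fix X :: "'a set" assume "X \<in> range (dyadic_cell n)"
    then obtain x where "X = dyadic_cell n x" by blast
    then have "X = {y. \<forall>b\<in>Basis. \<lfloor>2 ^ k * (y \<bullet> b)\<rfloor> = restrict (\<lambda>b. \<lfloor>2 ^ k * (x \<bullet> b)\<rfloor>) Basis b}"
      by (simp add: Suc)
    then show "X \<in> (\<lambda>c. {y. \<forall>b\<in>Basis. \<lfloor>2 ^ k * (y \<bullet> b)\<rfloor> = c b}) ` (\<Pi>\<^sub>E b\<in>(Basis :: 'a set). (UNIV :: int set))"
      by (rule image_eqI[where x = "restrict (\<lambda>b. \<lfloor>2 ^ k * (x \<bullet> b)\<rfloor>) Basis"]) simp
  qed
  then show ?thesis by (rule countable_subset) (intro countable_image countable_PiE, auto)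
qed

text \<open>Only null sets are compared, because the cost 1 of the root does not control its
  infinite \<open>diam_power\<close>; cheap covers avoid the root and translate cell by
  cell.\<close>

lemma Hausdorff_content_eq_0_dyadic:
  fixes E :: "'a::euclidean_space set"
  assumes "0 < s" "dyadic_content s E = 0"
  shows "Hausdorff_content s E = 0"
proof -
  interpret nested_partitions "dyadic_cell :: nat \<Rightarrow> 'a \<Rightarrow> 'a set" "dyadic_weight s"
    using assms(1) by (rule nested_partitions_dyadic)
  let ?K = "DIM('a) powr s"
  have K: "0 < ?K" by simp
  have "Hausdorff_content s E \<le> 0 + ennreal e" if "0 < e" for e
  proof -
    \<comment> \<open>The bound 1 keeps the root out of the cover; dividing by \<open>?K\<close>
      absorbs the factor of \<open>diam_power_dyadic_cell_le\<close>.\<close>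
    have "dyadic_content s E < min 1 (ennreal (e / ?K))" using assms that by simp
    then obtain N where N: "N \<subseteq> nodes" "E \<subseteq> (\<Union>p\<in>N. snd p)" "total_cost N < min 1 (ennreal (e / ?K))"
      by (rule net_content_less_cover)
    have "nodes \<subseteq> (\<Union>n. Pair n ` range (dyadic_cell n :: 'a \<Rightarrow> 'a set))" unfolding nodes_def by blast
    then have "countable nodes"
      by (rule countable_subset) (intro countable_UN countable_image countable_range_dyadic_cell, simp)
    then have "countable N" using N(1) countable_subset by blast
    define A where "A i = {p \<in> N. to_nat_on N p = i}" for i
    define U where "U i = (\<Union>p\<in>A i. snd p)" for i
    have "diam_power s (U i) \<le> ennreal ?K * total_cost (A i)" for i
    proof (cases "A i = {}")
      case False
      then obtain p where p: "p \<in> A i" by blast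
      then have "A i = {p}"
        using inj_on_to_nat_on[OF \<open>countable N\<close>] unfolding A_def inj_on_def by blast
      then have total: "total_cost (A i) = cost p"
        by (simp add: total_cost_def emeasure_weight_measure_finite)
      have "p \<in> N" using p by (simp add: A_def)
      then obtain n x where nx: "p = (n, dyadic_cell n x)" using N(1) unfolding nodes_def by blast
      have "cost p < 1" using cost_le_total_cost[OF \<open>p \<in> N\<close>] N(3) by (auto intro: order.strict_trans1)
      then obtain k where k: "n = Suc k" using nx by (cases n) (auto simp: cost_def)
      show ?thesis
        using diam_power_dyadic_cell_le[OF assms(1), of k x] unfolding total
        by (simp add: U_def \<open>A i = {p}\<close> nx k cost_def del: dyadic_cell.simps dyadic_weight.simps)
    qed (simp add: U_def)
    moreover have "E \<subseteq> (\<Union>i. U i)" using N(2) unfolding U_def A_def by blast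
    ultimately have "Hausdorff_content s E \<le> (\<Sum>i. ennreal ?K * total_cost (A i))"
      by (intro order_trans[OF Hausdorff_content_le_cover[OF assms(1)] suminf_le]) auto
    also have "\<dots> = ennreal ?K * (\<Sum>i. total_cost (A i))" by simp
    also have "(\<Sum>i. total_cost (A i)) = total_cost (\<Union>i. A i)"
      unfolding total_cost_def by (rule suminf_emeasure) (auto simp: A_def disjoint_family_on_def)
    also have "(\<Union>i. A i) = N" unfolding A_def by blast
    also have "ennreal ?K * total_cost N \<le> ennreal ?K * ennreal (e / ?K)"
      using N(3) by (intro mult_left_mono) (auto simp: less_imp_le)
    also have "\<dots> = 0 + ennreal e" using K that by (simp flip: ennreal_mult)
    finally show ?thesis .
  qed
  then have "Hausdorff_content s E \<le> 0" by (rule ennreal_le_epsilon)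
  then show ?thesis by simp
qed

section \<open>Compact subsets of analytic sets\<close>

text \<open>Basic open boxes restrict only finitely many coordinates; \<open>k\<close> lies beyond
  all of them.\<close>

lemma open_contains_cylinder:
  assumes "open X" "y \<in> X"
  obtains k where "\<And>z :: nat \<Rightarrow> nat. (\<And>i. i < k \<Longrightarrow> z i = y i) \<Longrightarrow> z \<in> X"
proof -
  have "openin (product_topology (\<lambda>_::nat. euclidean :: nat topology) UNIV) X"
    using assms(1) by (simp add: euclidean_product_topology)
  then obtain W where W: "y \<in> (\<Pi>\<^sub>E i\<in>UNIV. W i)" "finite {i. W i \<noteq> (UNIV :: nat set)}" "(\<Pi>\<^sub>E i\<in>UNIV. W i) \<subseteq> X"
    using product_topology_open_contains_basis[OF _ assms(2)] by force
  obtain k where k: "\<And>i. W i \<noteq> UNIV \<Longrightarrow> i < k"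
    using W(2) finite_nat_set_iff_bounded[of "{i. W i \<noteq> UNIV}"] by auto
  show ?thesis
  proof (rule that[of k])
    fix z assume z: "\<And>i. i < k \<Longrightarrow> z i = y i"
    have "z i \<in> W i" for i
    proof (cases "i < k")
      case True
      then show ?thesis using z[OF True] W(1) by (auto simp: PiE_iff)
    next
      case False
      then show ?thesis using k[of i] by auto
    qed
    then show "z \<in> X" using W(3) by blast
  qed
qed

lemma compact_nat_box: "compact {x :: nat \<Rightarrow> nat. \<forall>i. x i \<le> \<sigma> i}"
proof -
  have "compactin (product_topology (\<lambda>_::nat. euclidean :: nat topology) UNIV) (\<Pi>\<^sub>E i\<in>UNIV. {..\<sigma> i})"
    by (simp add: compactin_PiE finite_imp_compact)
  moreover have "(\<Pi>\<^sub>E i\<in>UNIV. {..\<sigma> i}) = {x. \<forall>i. x i \<le> \<sigma> i}" by auto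
  ultimately show ?thesis by (simp add: euclidean_product_topology)
qed

text \<open>Compactness makes one \<open>k\<close> serve all points of the box. Truncating a point
  by \<open>min\<close> then moves it into the box without changing its first \<open>k\<close>
  coordinates.\<close>

lemma open_superset_nat_box:
  assumes "open X" "{x :: nat \<Rightarrow> nat. \<forall>i. x i \<le> \<sigma> i} \<subseteq> X"
  obtains k where "{x. \<forall>i<k. x i \<le> \<sigma> i} \<subseteq> X"
proof -
  let ?P = "{x :: nat \<Rightarrow> nat. \<forall>i. x i \<le> \<sigma> i}"
  \<comment> \<open>A union of open sets, so openness is immediate; its points have their
    \<open>k\<close>-cylinder inside \<open>X\<close>.\<close>
  define Y where "Y k = (\<Union>{C. open C \<and> (\<forall>x\<in>C. \<forall>z. (\<forall>i<k. z i = x i) \<longrightarrow> z \<in> X)})" for k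
  have cover: "?P \<subseteq> (\<Union>k\<in>UNIV. Y k)"
  proof
    fix y assume "y \<in> ?P"
    then have "y \<in> X" using assms by blast
    then obtain k where k: "\<And>z. (\<And>i. i < k \<Longrightarrow> z i = y i) \<Longrightarrow> z \<in> X"
      using open_contains_cylinder[OF assms(1)] by blast
    let ?C = "{z. \<forall>i\<in>{..<k}. z i \<in> {y i}}"
    have "open ?C" by (rule product_topology_basis'[where x = "\<lambda>i. i"]) (auto intro: open_discrete)
    moreover have "\<forall>x\<in>?C. \<forall>z. (\<forall>i<k. z i = x i) \<longrightarrow> z \<in> X" using k by auto
    ultimately have "?C \<subseteq> Y k" unfolding Y_def by blast
    then show "y \<in> (\<Union>k\<in>UNIV. Y k)" by auto
  qed
  have opn: "open (Y k)" if "k \<in> UNIV" for k unfolding Y_def by auto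
  obtain I where I: "finite I" "?P \<subseteq> (\<Union>k\<in>I. Y k)"
    by (rule compactE_image[OF compact_nat_box opn cover])
  obtain k where k: "\<And>i. i \<in> I \<Longrightarrow> i \<le> k"
    using I(1) finite_nat_set_iff_bounded_le[of I] by auto
  show ?thesis
  proof (rule that[of k], rule subsetI)
    fix x assume x: "x \<in> {x. \<forall>i<k. x i \<le> \<sigma> i}"
    define y where "y i = min (x i) (\<sigma> i)" for i
    have "y \<in> ?P" by (simp add: y_def)
    then obtain j where "j \<in> I" "y \<in> Y j" using I(2) by blast
    then have "\<forall>z. (\<forall>i<j. z i = y i) \<longrightarrow> z \<in> X" unfolding Y_def by blast
    moreover have "\<forall>i<j. x i = y i" using x k[OF \<open>j \<in> I\<close>] by (auto simp: y_def min_def)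
    ultimately show "x \<in> X" by blast
  qed
qed

text \<open>Continuity from below fixes the bounds on the coordinates one after the other.\<close>

lemma nat_box_above:
  fixes M :: "'a set \<Rightarrow> ennreal" and f :: "(nat \<Rightarrow> nat) \<Rightarrow> 'a"
  assumes M: "\<And>E. incseq E \<Longrightarrow> M (\<Union>i. E i) = (SUP i. M (E i))" and c: "c < M (range f)"
  obtains \<sigma> where "\<And>k. c < M (f ` {x. \<forall>i<k. x i \<le> \<sigma> i})"
proof -
  have step: "\<exists>h. c < M (f ` {x. \<forall>i<Suc k. x i \<le> h i}) \<and> (\<forall>i<k. h i = g i)"
    if g: "c < M (f ` {x. \<forall>i<k. x i \<le> g i})" for g and k :: nat
  proof -
    \<comment> \<open>Capping coordinate \<open>k\<close> at \<open>n\<close> gives an increasing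
      sequence that exhausts the previous stage.\<close>
    define E where "E n = f ` {x. (\<forall>i<k. x i \<le> g i) \<and> x k \<le> n}" for n :: nat
    have "incseq E" unfolding E_def incseq_def by (intro allI impI image_mono) auto
    moreover have "(\<Union>n. E n) = f ` {x. \<forall>i<k. x i \<le> g i}" unfolding E_def by blast
    ultimately have "c < (SUP n. M (E n))" using M[of E] g by simp
    then obtain n where n: "c < M (E n)" by (auto simp: less_SUP_iff)
    have "E n = f ` {x. \<forall>i<Suc k. x i \<le> (g(k := n)) i}"
      unfolding E_def by (auto simp: less_Suc_eq)
    with n show ?thesis by (intro exI[of _ "g(k := n)"]) auto
  qed
  have "\<exists>g. \<forall>k. c < M (f ` {x. \<forall>i<k. x i \<le> g k i}) \<and> (\<forall>i<k. g (Suc k) i = g k i)"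
    using c step by (intro dependent_nat_choice) auto
  then obtain g where g: "\<And>k. c < M (f ` {x. \<forall>i<k. x i \<le> g k i})"
    "\<And>k i. i < k \<Longrightarrow> g (Suc k) i = g k i" by blast
  \<comment> \<open>Coordinate \<open>i\<close> is settled at stage \<open>Suc i\<close>, so the
    diagonal agrees with \<open>g k\<close> below \<open>k\<close>.\<close>
  have geq: "g k i = g (Suc i) i" if "Suc i \<le> k" for i k
    using that by (induction k rule: dec_induct) (use g(2) in auto)
  have eq: "{x. \<forall>i<k. x i \<le> g k i} = {x. \<forall>i<k. x i \<le> g (Suc i) i}" for k
  proof -
    have "x i \<le> g k i \<longleftrightarrow> x i \<le> g (Suc i) i" if "i < k" for x i
      using geq[of i k] that by (simp only: Suc_le_eq)
    then show ?thesis by blast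
  qed
  show ?thesis using g(1) unfolding eq by (rule that)
qed

text \<open>\<open>nat_box_above\<close> keeps the dyadic content of every finite-stage image above
  \<open>c\<close>. Were the image of the full box null, an open superset of tiny Hausdorff content
  would contain some finite-stage image, contradicting this through the comparison of
  contents.\<close>

theorem analytic_compact_subset:
  fixes K :: "'a::euclidean_space set"
  assumes "0 < s" "analytic_set K" "0 < Hausdorff_measure s K"
  obtains E where "compact E" "E \<subseteq> K" "0 < Hausdorff_content s E"
proof -
  interpret nested_partitions "dyadic_cell :: nat \<Rightarrow> 'a \<Rightarrow> 'a set" "dyadic_weight s"
    using assms(1) by (rule nested_partitions_dyadic)
  have "Hausdorff_content s K \<noteq> 0" using assms Hausdorff_measure_eq_0 by force
  then have pos: "dyadic_content s K \<noteq> 0" using Hausdorff_content_eq_0_dyadic[OF assms(1)] by blast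
  then have "K \<noteq> {}" by auto
  then obtain f :: "(nat \<Rightarrow> nat) \<Rightarrow> 'a" where f: "continuous_on UNIV f" "range f = K"
    using assms(2) unfolding analytic_set_def by blast
  obtain c where c: "0 < c" "c < dyadic_content s K"
    using pos dense[of 0 "dyadic_content s K"] by (auto simp: zero_less_iff_neq_zero)
  have "c < dyadic_content s (range f)" using c f by simp
  then obtain \<sigma> where \<sigma>: "\<And>k. c < dyadic_content s (f ` {x. \<forall>i<k. x i \<le> \<sigma> i})"
    using nat_box_above[of "dyadic_content s" c f, OF net_content_UN_incseq] by blast
  let ?P = "{x. \<forall>i. x i \<le> \<sigma> i}"
  define C where "C = ennreal (3 ^ DIM('a) * 2 powr s)"
  have C: "0 < C" "C < top" unfolding C_def by auto
  show ?thesis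
  proof (rule that[of "f ` ?P"])
    show "compact (f ` ?P)"
      using compact_nat_box f(1) by (meson compact_continuous_image continuous_on_subset subset_UNIV)
    show "f ` ?P \<subseteq> K" using f by blast
    show "0 < Hausdorff_content s (f ` ?P)"
    proof (rule ccontr)
      assume "\<not> 0 < Hausdorff_content s (f ` ?P)"
      then have "Hausdorff_content s (f ` ?P) = 0" by (simp add: zero_less_iff_neq_zero)
      \<comment> \<open>The threshold that the comparison factor \<open>C\<close> turns into
        \<open>c\<close>.\<close>
      moreover have "0 < c / C" using c C by (simp add: ennreal_zero_less_divide)
      ultimately have "Hausdorff_content s (f ` ?P) < c / C" by simp
      then obtain V where V: "open V" "f ` ?P \<subseteq> V" "Hausdorff_content s V < c / C"
        by (rule Hausdorff_content_less_open)
      have "open (f -` V)" using f(1) V(1) by (simp add: open_vimage continuous_on_eq_continuous_at)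
      moreover have "?P \<subseteq> f -` V" using V(2) by blast
      ultimately obtain k where "{x. \<forall>i<k. x i \<le> \<sigma> i} \<subseteq> f -` V"
        by (rule open_superset_nat_box)
      then have "dyadic_content s (f ` {x. \<forall>i<k. x i \<le> \<sigma> i}) \<le> dyadic_content s V"
        by (intro net_content_mono) blast
      also have "\<dots> < C * (c / C)"
        unfolding C_def by (rule dyadic_content_less[OF assms(1) V(3)[unfolded C_def]])
      also have "\<dots> = c" using C by (simp add: ennreal_times_divide mult.commute[of C] mult_divide_eq_ennreal)
      finally show False using \<sigma>[of k] by simp
    qed
  qed
qed

section \<open>Tangents of large content\<close>

text \<open>Pulling a cover of the image back along the similarity divides diameters by
  \<open>c\<close>.\<close>

lemma Hausdorff_content_scale:
  fixes A :: "'a::real_normed_vector set"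
  assumes "0 < s" "0 < c"
  shows "ennreal (c powr s) * Hausdorff_content s A \<le> Hausdorff_content s ((\<lambda>y. c *\<^sub>R (y - x)) ` A)"
  unfolding Hausdorff_content_def[of s "(\<lambda>y. c *\<^sub>R (y - x)) ` A"]
proof (rule INF_greatest, clarify)
  fix V :: "nat \<Rightarrow> 'a set"
  assume V: "(\<lambda>y. c *\<^sub>R (y - x)) ` A \<subseteq> (\<Union>i. V i)"
  define W where "W i = (\<lambda>y. c *\<^sub>R (y - x)) -` V i" for i
  have W: "ennreal (c powr s) * diam_power s (W i) \<le> diam_power s (V i)" for i
  proof -
    consider "W i = {}" | "\<not> bounded (V i)" | "W i \<noteq> {}" "bounded (V i)" by blast
    then show ?thesis
    proof cases
      case 2
      then show ?thesis using assms by (auto simp: diam_power_def)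
    next
      case 3
      have le: "dist y z \<le> diameter (V i) / c" if "y \<in> W i" "z \<in> W i" for y z
      proof -
        have "dist (c *\<^sub>R (y - x)) (c *\<^sub>R (z - x)) \<le> diameter (V i)"
          using 3 that unfolding W_def by (intro diameter_bounded_bound) auto
        moreover have "dist (c *\<^sub>R (y - x)) (c *\<^sub>R (z - x)) = c * dist y z"
          using assms by (simp add: dist_norm flip: scaleR_diff_right)
        ultimately show ?thesis using assms by (simp add: field_simps)
      qed
      have "bounded (W i)" unfolding bounded_two_points using le by blast
      moreover have "diameter (W i) \<le> diameter (V i) / c"
        using le 3 by (intro diameter_le) (auto simp: dist_norm)
      ultimately have "diam_power s (W i) \<le> ennreal ((diameter (V i) / c) powr s)"
        by (intro diam_power_le assms)
      then have "ennreal (c powr s) * diam_power s (W i) \<le> ennreal (c powr s) * ennreal ((diameter (V i) / c) powr s)"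
        by (rule mult_left_mono) simp
      also have "\<dots> = ennreal ((c * (diameter (V i) / c)) powr s)"
        by (subst powr_mult) (simp add: ennreal_mult)
      also have "\<dots> = diam_power s (V i)"
        using 3 assms W_def by (auto simp: diam_power_def)
      finally show ?thesis .
    qed simp
  qed
  have "A \<subseteq> (\<Union>i. W i)" using V unfolding W_def by blast
  then have "ennreal (c powr s) * Hausdorff_content s A \<le> ennreal (c powr s) * (\<Sum>i. diam_power s (W i))"
    using assms by (intro mult_left_mono Hausdorff_content_le_cover) auto
  also have "\<dots> = (\<Sum>i. ennreal (c powr s) * diam_power s (W i))" by simp
  also have "\<dots> \<le> (\<Sum>i. diam_power s (V i))" by (intro suminf_le W) auto
  finally show "ennreal (c powr s) * Hausdorff_content s A \<le> (\<Sum>i. diam_power s (V i))" .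
qed

text \<open>The exceptional sets are null and compact, so they can be cut out by open sets of small content.\<close>

lemma compact_subset_dense_points:
  fixes K :: "'a::euclidean_space set" and q :: "nat \<Rightarrow> real"
  assumes "0 < s" "compact K" "0 < Hausdorff_content s K" and q: "\<And>n. 0 < q n" "\<And>n. q n < 1"
  obtains E where "compact E" "E \<subseteq> K" "0 < Hausdorff_content s E"
    "\<forall>x\<in>E. \<forall>n. \<exists>U. open U \<and> bounded U \<and> x \<in> U \<and> diameter U < 1 / real (Suc n) \<and>
       ennreal (q n) * diam_power s U < Hausdorff_content s (K \<inter> U)"
proof -
  define G where "G n = {U. open U \<and> bounded U \<and> diameter U < 1 / real (Suc n) \<and>
       ennreal (q n) * diam_power s U < Hausdorff_content s (K \<inter> U)}" for n
  \<comment> \<open>The points in no good set of stage \<open>n\<close>; compact because the good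
    sets are open.\<close>
  define B where "B n = K - \<Union>(G n)" for n
  \<comment> \<open>The content allowed for all removed open sets together; being below that of
    \<open>K\<close>, it leaves positive content.\<close>
  obtain e where e: "0 < e" "ennreal e < Hausdorff_content s K"
  proof -
    obtain z where z: "0 < z" "z < Hausdorff_content s K" using assms(3) dense by blast
    then obtain e where "z = ennreal e" "0 \<le> e" by (cases z) auto
    with z that[of e] show ?thesis by simp
  qed
  have "Hausdorff_content s (B n) = 0" for n
  proof (rule Hausdorff_content_eq_0[OF assms(1) q, where \<delta> = "1 / real (Suc n)" and K = K])
    have "open (\<Union>(G n))" unfolding G_def by auto
    then show "compact (B n)" unfolding B_def by (rule compact_diff[OF assms(2)])
    show "Hausdorff_content s (K \<inter> U) \<le> ennreal (q n) * diam_power s U"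
      if "open U" "bounded U" "diameter U < 1 / real (Suc n)" "U \<inter> B n \<noteq> {}" for U
    proof (rule ccontr)
      assume "\<not> ?thesis"
      then have "U \<in> G n" using that by (simp add: G_def not_le)
      with that(4) show False unfolding B_def by blast
    qed
  qed (auto simp: B_def)
  then have "\<exists>V. open V \<and> B n \<subseteq> V \<and> Hausdorff_content s V < ennreal (e * (1 / 2) ^ Suc n)" for n
  proof -
    have "Hausdorff_content s (B n) < ennreal (e * (1 / 2) ^ Suc n)"
      using \<open>Hausdorff_content s (B n) = 0\<close> e by simp
    then show ?thesis by (rule Hausdorff_content_less_open) blast
  qed
  then obtain V where V: "\<And>n. open (V n)" "\<And>n. B n \<subseteq> V n"
    "\<And>n. Hausdorff_content s (V n) < ennreal (e * (1 / 2) ^ Suc n)" by metis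
  show ?thesis
  proof (rule that[of "K - (\<Union>n. V n)"])
    show "compact (K - (\<Union>n. V n))" using V(1) by (intro compact_diff[OF assms(2)]) auto
    show "0 < Hausdorff_content s (K - (\<Union>n. V n))"
    proof (rule ccontr)
      assume "\<not> ?thesis"
      then have 0: "Hausdorff_content s (K - (\<Union>n. V n)) = 0" by (simp add: zero_less_iff_neq_zero)
      have "Hausdorff_content s K \<le> Hausdorff_content s ((K - (\<Union>n. V n)) \<union> (\<Union>n. V n))"
        by (rule Hausdorff_content_mono) blast
      also have "\<dots> \<le> 0 + Hausdorff_content s (\<Union>n. V n)"
        unfolding 0[symmetric] by (rule Hausdorff_content_Un_le)
      also have "\<dots> \<le> 0 + (\<Sum>n. 0 + ennreal (e * (1 / 2) ^ Suc n))"
        using V(3) by (intro add_left_mono order_trans[OF Hausdorff_content_UN_le suminf_le])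
          (auto simp: less_imp_le)
      also have "\<dots> = ennreal e"
        using suminf_add_half_series[of e "\<lambda>_. 0"] e by (simp only: suminf_zero add_0_left less_imp_le)
      finally show False using e by simp
    qed
    have "x \<in> \<Union>(G n)" if "x \<in> K - (\<Union>n. V n)" for x n
      using that V(2)[of n] unfolding B_def by blast
    then show "\<forall>x\<in>K - (\<Union>n. V n). \<forall>n. \<exists>U. open U \<and> bounded U \<and> x \<in> U \<and> diameter U < 1 / real (Suc n) \<and>
       ennreal (q n) * diam_power s U < Hausdorff_content s (K \<inter> U)"
      unfolding G_def by blast
  qed auto
qed

section \<open>Hausdorff convergence and existence of tangents\<close>

lemma bdd_above_infdist:
  assumes "bounded A" "B \<noteq> {}"
  shows "bdd_above ((\<lambda>a. infdist a B) ` A)"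
proof -
  obtain b where "b \<in> B" using assms(2) by blast
  obtain r where "\<And>a. a \<in> A \<Longrightarrow> dist b a \<le> r" using assms(1) bounded_any_center by metis
  then have "infdist a B \<le> r" if "a \<in> A" for a
    using infdist_le[OF \<open>b \<in> B\<close>, of a] that by (metis dist_commute order_trans)
  then show ?thesis by (rule bdd_aboveI2)
qed

lemma infdist_le_Hausdorff_dist:
  assumes "bounded A" "B \<noteq> {}" "a \<in> A"
  shows "infdist a B \<le> Hausdorff_dist A B"
  unfolding Hausdorff_dist_def
  using cSUP_upper[OF assms(3) bdd_above_infdist[OF assms(1,2)]] by simp

lemma Hausdorff_dist_nonneg:
  assumes "bounded A" "A \<noteq> {}" "B \<noteq> {}"
  shows "0 \<le> Hausdorff_dist A B"
proof -
  obtain a where "a \<in> A" using assms by blast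
  then show ?thesis
    using infdist_le_Hausdorff_dist[OF assms(1,3)] infdist_nonneg order_trans by blast
qed

text \<open>Blaschke selection: the distance functions of the sets are 1-Lipschitz, hence converge
  uniformly along a subsequence, and the zero set of the limit is the Hausdorff limit.\<close>

lemma Hausdorff_dist_convergent_subsequence:
  fixes G :: "nat \<Rightarrow> 'a::euclidean_space set"
  assumes S: "compact S" and G: "\<And>n. compact (G n)" "\<And>n. G n \<noteq> {}" "\<And>n. G n \<subseteq> S"
  obtains F k where "strict_mono k" "compact F" "F \<noteq> {}" "F \<subseteq> S"
    "(\<lambda>n. Hausdorff_dist (G (k n)) F) \<longlonglongrightarrow> 0"
proof -
  obtain r where r: "\<And>x y. x \<in> S \<Longrightarrow> y \<in> S \<Longrightarrow> dist x y \<le> r"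
    using compact_imp_bounded[OF S] unfolding bounded_two_points by blast
  obtain g k where g: "continuous_on S g" and k: "strict_mono (k :: nat \<Rightarrow> nat)"
    and unif: "\<And>e. 0 < e \<Longrightarrow> \<exists>N. \<forall>n x. n \<ge> N \<and> x \<in> S \<longrightarrow> norm (infdist x (G (k n)) - g x) < e"
  proof (rule Arzela_Ascoli[OF S, of "\<lambda>n x. infdist x (G n)" r])
    show "norm (infdist x (G n)) \<le> r" if "x \<in> S" for n x
    proof -
      obtain y where "y \<in> G n" using G(2) by blast
      then show ?thesis using infdist_le[of y "G n" x] r[OF that] G(3)
        by (auto simp: infdist_nonneg intro: order_trans)
    qed
    show "\<exists>d>0. \<forall>n y. y \<in> S \<and> norm (x - y) < d \<longrightarrow> norm (infdist x (G n) - infdist y (G n)) < e"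
      if "0 < e" for x e
    proof (intro exI[of _ e] conjI allI impI)
      fix n y assume "y \<in> S \<and> norm (x - y) < e"
      then show "norm (infdist x (G n) - infdist y (G n)) < e"
        using infdist_triangle_abs[of x "G n" y] by (simp add: dist_norm)
    qed (rule that)
  qed auto
  define F where "F = {x \<in> S. g x = 0}"
  have lim: "(\<lambda>n. infdist x (G (k n))) \<longlonglongrightarrow> g x" if "x \<in> S" for x
    unfolding LIMSEQ_iff using unif that by blast
  \<comment> \<open>\<open>g x\<close> is realised as a distance to \<open>F\<close>: nearest points
    of \<open>G (k n)\<close> accumulate at a point where \<open>g\<close> vanishes.\<close>
  have near: "\<exists>z\<in>F. dist x z = g x" if x: "x \<in> S" for x
  proof -
    have "\<exists>z\<in>G (k n). infdist x (G (k n)) = dist x z" for n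
      using infdist_attains_inf[OF compact_imp_closed[OF G(1)] G(2)] by metis
    then obtain z where z: "\<And>n. z n \<in> G (k n)" "\<And>n. infdist x (G (k n)) = dist x (z n)" by metis
    then have "\<forall>n. z n \<in> S" using G(3) by blast
    then obtain y l where y: "y \<in> S" "strict_mono (l :: nat \<Rightarrow> nat)" "(z \<circ> l) \<longlonglongrightarrow> y"
      using S unfolding compact_def by metis
    have "(\<lambda>n. dist x (z (l n))) \<longlonglongrightarrow> dist x y"
      using y(3) by (intro tendsto_dist) (auto simp: o_def)
    moreover have "(\<lambda>n. dist x (z (l n))) \<longlonglongrightarrow> g x"
      using LIMSEQ_subseq_LIMSEQ[OF lim[OF x] y(2)] by (simp add: o_def z(2))
    ultimately have "dist x y = g x" by (rule LIMSEQ_unique)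
    moreover have "(\<lambda>n. infdist y (G (k (l n)))) \<longlonglongrightarrow> 0"
    proof (rule tendsto_sandwich[of "\<lambda>_. 0"])
      show "(\<lambda>n. dist y (z (l n))) \<longlonglongrightarrow> 0"
        using tendsto_dist[OF tendsto_const y(3), of y] by (simp add: o_def)
      show "\<forall>\<^sub>F n in sequentially. infdist y (G (k (l n))) \<le> dist y (z (l n))"
        using z(1) by (intro always_eventually allI infdist_le)
    qed (auto simp: infdist_nonneg)
    then have "g y = 0"
      using LIMSEQ_subseq_LIMSEQ[OF lim[OF y(1)] y(2)] by (auto simp: o_def intro: LIMSEQ_unique)
    ultimately show ?thesis using y(1) unfolding F_def by blast
  qed
  show ?thesis
  proof (rule that[OF k])
    have "closed F"
      unfolding F_def by (rule continuous_closed_preimage_constant[OF g compact_imp_closed[OF S]])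
    moreover have "F = S \<inter> F" unfolding F_def by blast
    ultimately show "compact F" using compact_Int_closed[OF S] by metis
    show "F \<noteq> {}" using near G(2,3) by blast
    show "F \<subseteq> S" unfolding F_def by blast
    show "(\<lambda>n. Hausdorff_dist (G (k n)) F) \<longlonglongrightarrow> 0"
    proof (rule LIMSEQ_I)
      fix e :: real assume "0 < e"
      then obtain N where N: "\<And>n x. \<lbrakk>n \<ge> N; x \<in> S\<rbrakk> \<Longrightarrow> norm (infdist x (G (k n)) - g x) < e / 2"
        using unif[of "e / 2"] by auto
      have "norm (Hausdorff_dist (G (k n)) F - 0) < e" if "n \<ge> N" for n
      proof -
        have "infdist a F \<le> e / 2" if a: "a \<in> G (k n)" for a
        proof -
          have "a \<in> S" using a G(3) by blast
          then obtain z where z: "z \<in> F" "dist a z = g a" using near by blast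
          \<comment> \<open>Here \<open>infdist a (G (k n)) = 0\<close>, so uniform closeness bounds
            \<open>g a\<close> itself.\<close>
          have "g a \<le> e / 2" using N[OF \<open>n \<ge> N\<close> \<open>a \<in> S\<close>] a by simp
          then show ?thesis using infdist_le[OF z(1), of a] z(2) by simp
        qed
        moreover have "infdist b (G (k n)) \<le> e / 2" if "b \<in> F" for b
          using N[OF \<open>n \<ge> N\<close>, of b] that by (simp add: F_def)
        ultimately have "Hausdorff_dist (G (k n)) F \<le> e / 2"
          unfolding Hausdorff_dist_def using G(2) \<open>F \<noteq> {}\<close> by (intro max.boundedI cSUP_least) auto
        moreover have "0 \<le> Hausdorff_dist (G (k n)) F"
          using G \<open>F \<noteq> {}\<close> by (intro Hausdorff_dist_nonneg) (auto simp: compact_imp_bounded)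
        ultimately show ?thesis using \<open>0 < e\<close> by simp
      qed
      then show "\<exists>N. \<forall>n\<ge>N. norm (Hausdorff_dist (G (k n)) F - 0) < e" by blast
    qed
  qed
qed

text \<open>An open superset of the compact set \<open>F\<close> contains an
  \<open>e\<close>-neighbourhood of \<open>F\<close>, hence \<open>G n\<close> for large
  \<open>n\<close>; its content then bounds theirs.\<close>

lemma Hausdorff_content_limit_ge:
  fixes F :: "'a::heine_borel set"
  assumes F: "compact F" "F \<noteq> {}" and G: "\<And>n. bounded (G n)" "\<And>n. a n \<le> Hausdorff_content s (G n)"
    and lim: "(\<lambda>n. Hausdorff_dist (G n) F) \<longlonglongrightarrow> 0" "a \<longlonglongrightarrow> c"
  shows "c \<le> Hausdorff_content s F"
proof (rule ccontr)
  assume "\<not> ?thesis"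
  then have "Hausdorff_content s F < c" by simp
  then obtain V where V: "open V" "F \<subseteq> V" "Hausdorff_content s V < c"
    by (rule Hausdorff_content_less_open)
  obtain e where e: "0 < e" "(\<Union>x\<in>F. ball x e) \<subseteq> V"
    using compact_subset_open_imp_ball_epsilon_subset[OF F(1) V(1,2)] by blast
  have "\<forall>\<^sub>F n in sequentially. Hausdorff_dist (G n) F < e \<and> Hausdorff_content s V < a n"
    using order_tendstoD(2)[OF lim(1) e(1)] order_tendstoD(1)[OF lim(2) V(3)] by eventually_elim auto
  then obtain n where n: "Hausdorff_dist (G n) F < e" "Hausdorff_content s V < a n"
    by (metis (no_types, lifting) eventually_happens trivial_limit_sequentially)
  have "G n \<subseteq> V"
  proof
    fix y assume "y \<in> G n"
    then have "infdist y F < e"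
      using infdist_le_Hausdorff_dist[OF G(1) F(2)] n(1) by (meson order.strict_trans1)
    then obtain z where "z \<in> F" "dist y z < e"
      using infdist_attains_inf[OF compact_imp_closed[OF F(1)] F(2), of y] by metis
    then show "y \<in> V" using e(2) by (auto simp: dist_commute subset_iff)
  qed
  then have "Hausdorff_content s (G n) \<le> Hausdorff_content s V" by (rule Hausdorff_content_mono)
  then show False using G(2)[of n] n(2) by simp
qed

lemma blowup_compact:
  fixes X :: "'a::euclidean_space set"
  assumes "closed X"
  shows "compact (blowup X x c)"
proof -
  have "(\<lambda>y. c *\<^sub>R (y - x)) ` X = (\<lambda>y. c *\<^sub>R y) ` (\<lambda>y. y - x) ` X" by (simp add: image_image)
  then have "closed ((\<lambda>y. c *\<^sub>R (y - x)) ` X)"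
    using closed_scaling[OF closed_translation_subtract[OF assms]] by simp
  then show ?thesis unfolding blowup_def by (intro closed_Int_compact) auto
qed

lemma zero_in_blowup: "x \<in> X \<Longrightarrow> 0 \<in> blowup X x c"
  unfolding blowup_def by force

text \<open>Blow-ups at a point of \<open>X\<close> contain 0, so Blaschke selection applies to any
  prescribed scales. The subsequence is returned because content bounds are attached to the
  scales.\<close>

lemma tangent_along_scales:
  fixes X :: "'a::euclidean_space set"
  assumes "closed X" "x \<in> X" "\<And>n. 0 < c n" "filterlim c at_top sequentially"
  obtains F k where "F \<in> Tan X x" "strict_mono (k :: nat \<Rightarrow> nat)"
    "(\<lambda>n. Hausdorff_dist (blowup X x (c (k n))) F) \<longlonglongrightarrow> 0"
proof -
  have ne: "blowup X x r \<noteq> {}" for r using zero_in_blowup[OF assms(2)] by blast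
  have sub: "blowup X x r \<subseteq> cball 0 1" for r unfolding blowup_def by blast
  obtain F k where F: "strict_mono (k :: nat \<Rightarrow> nat)" "compact F" "F \<noteq> {}" "F \<subseteq> cball 0 1"
    "(\<lambda>n. Hausdorff_dist (blowup X x (c (k n))) F) \<longlonglongrightarrow> 0"
    by (rule Hausdorff_dist_convergent_subsequence[OF compact_cball blowup_compact[OF assms(1)] ne sub])
  have "filterlim (\<lambda>n. c (k n)) at_top sequentially"
    using filterlim_compose[OF assms(4) filterlim_subseq[OF F(1)]] .
  then have "F \<in> Tan X x"
    unfolding Tan_def using F assms(3) ne blowup_compact[OF assms(1)]
    by (auto intro!: exI[of _ "\<lambda>n. c (k n)"])
  then show ?thesis using F that by blast
qed

section \<open>Exponent 0, where every nonempty set costs 1\<close>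

lemma one_le_diam_power_0_cover:
  assumes "E \<noteq> {}" "E \<subseteq> (\<Union>i. U i)"
  shows "1 \<le> (\<Sum>i. diam_power 0 (U i))"
proof (rule ccontr)
  assume "\<not> ?thesis"
  then have less: "diam_power 0 (U i) < 1" for i
    using ennreal_suminf_lessD[of "\<lambda>i. diam_power 0 (U i)"] by simp
  have "U i = {}" for i using less[of i] by (auto simp: diam_power_def split: if_splits)
  with assms show False by simp
qed

lemma Hausdorff_measure_0_pos:
  assumes "E \<noteq> {}"
  shows "0 < Hausdorff_measure 0 E"
proof -
  have "0 < (1::ennreal)" by simp
  also have "1 \<le> Hausdorff_premeasure 0 1 E"
    unfolding Hausdorff_premeasure_def using one_le_diam_power_0_cover[OF assms] by (intro INF_greatest) auto
  also have "\<dots> \<le> Hausdorff_measure 0 E" unfolding Hausdorff_measure_def by (rule SUP_upper) simp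
  finally show ?thesis .
qed

lemma Hausdorff_content_0_ge_1: "E \<noteq> {} \<Longrightarrow> 1 \<le> Hausdorff_content 0 E"
  unfolding Hausdorff_content_def using one_le_diam_power_0_cover by (intro INF_greatest) auto

section \<open>Tangents at points of large relative content\<close>

lemma exists_tangent_content_ge_1:
  fixes X :: "'a::euclidean_space set"
  assumes "0 < s" "closed X" "x \<in> X" "K \<subseteq> X" and q: "\<And>n. 0 \<le> q n" "q \<longlonglongrightarrow> 1"
    and dense: "\<And>n. \<exists>U. open U \<and> bounded U \<and> x \<in> U \<and> diameter U < 1 / real (Suc n) \<and>
       ennreal (q n) * diam_power s U < Hausdorff_content s (K \<inter> U)"
  shows "\<exists>F\<in>Tan X x. 1 \<le> Hausdorff_content s F"
proof -
  obtain U where U: "\<And>n. open (U n)" "\<And>n. bounded (U n)" "\<And>n. x \<in> U n"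
    "\<And>n. diameter (U n) < 1 / real (Suc n)"
    "\<And>n. ennreal (q n) * diam_power s (U n) < Hausdorff_content s (K \<inter> U n)"
    using dense by metis
  \<comment> \<open>An open set containing \<open>x\<close> is not a single point, so it can be
    rescaled to diameter 1.\<close>
  have pos: "0 < diameter (U n)" for n
  proof -
    obtain r where r: "0 < r" "ball x r \<subseteq> U n" using U(1,3) by (meson openE)
    then have "2 * r \<le> diameter (U n)" using diameter_subset[OF r(2) U(2)] by simp
    with r show ?thesis by simp
  qed
  define c where "c n = 1 / diameter (U n)" for n
  have c: "0 < c n" for n using pos by (simp add: c_def)
  have lim: "filterlim c at_top sequentially"
  proof (rule filterlim_at_top_mono[OF filterlim_real_sequentially])
    show "\<forall>\<^sub>F n in sequentially. real n \<le> c n"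
    proof (intro always_eventually allI)
      fix n
      have "real n * diameter (U n) \<le> real (Suc n) * (1 / real (Suc n))"
        using U(4)[of n] pos[of n] by (intro mult_mono) auto
      then show "real n \<le> c n" using pos[of n] by (simp add: c_def field_simps)
    qed
  qed
  obtain F k where F: "F \<in> Tan X x" "strict_mono (k :: nat \<Rightarrow> nat)"
    "(\<lambda>n. Hausdorff_dist (blowup X x (c (k n))) F) \<longlonglongrightarrow> 0"
    by (rule tangent_along_scales[OF assms(2,3) c lim])
  have ge: "ennreal (q n) \<le> Hausdorff_content s (blowup X x (c n))" for n
  proof -
    \<comment> \<open>Scaling multiplies content by \<open>c n powr s\<close>, the reciprocal of
      \<open>diameter (U n) powr s\<close>, which turns the density bound into
      \<open>q n\<close>.\<close>
    have "ennreal (q n) = ennreal (c n powr s) * (ennreal (q n) * diam_power s (U n))"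
    proof -
      have "c n powr s * diameter (U n) powr s = 1"
        using pos[of n] by (simp add: c_def flip: powr_mult)
      moreover have "diam_power s (U n) = ennreal (diameter (U n) powr s)"
        using U(2,3)[of n] assms(1) by (auto simp: diam_power_def)
      ultimately show ?thesis using q(1)[of n]
        by (simp add: mult.left_commute[of _ "ennreal (q n)"] flip: ennreal_mult)
    qed
    also have "\<dots> \<le> ennreal (c n powr s) * Hausdorff_content s (K \<inter> U n)"
      using U(5) by (intro mult_left_mono) (auto simp: less_imp_le)
    also have "\<dots> \<le> Hausdorff_content s ((\<lambda>y. c n *\<^sub>R (y - x)) ` (K \<inter> U n))"
      by (rule Hausdorff_content_scale[OF assms(1) c])
    also have "\<dots> \<le> Hausdorff_content s (blowup X x (c n))"
    proof (rule Hausdorff_content_mono)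
      \<comment> \<open>Since \<open>x\<close> itself lies in \<open>U n\<close>, the rescaled set
        of diameter 1 fits into the unit ball about 0.\<close>
      have "norm (c n *\<^sub>R (y - x)) \<le> 1" if "y \<in> U n" for y
      proof -
        have "norm (c n *\<^sub>R (y - x)) = c n * dist y x" using c[of n] by (simp only: norm_scaleR dist_norm abs_of_pos)
        also have "\<dots> \<le> 1"
          using diameter_bounded_bound[OF U(2) that U(3)] pos[of n] by (simp add: c_def)
        finally show ?thesis .
      qed
      then show "(\<lambda>y. c n *\<^sub>R (y - x)) ` (K \<inter> U n) \<subseteq> blowup X x (c n)"
        using assms(4) unfolding blowup_def by auto
    qed
    finally show ?thesis .
  qed
  have "1 \<le> Hausdorff_content s F"
  proof (rule Hausdorff_content_limit_ge[where a = "\<lambda>n. ennreal (q (k n))"])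
    show "compact F" "F \<noteq> {}" using F(1) unfolding Tan_def by auto
    show "bounded (blowup X x (c (k n)))" for n
      using blowup_compact[OF assms(2)] by (rule compact_imp_bounded)
    show "(\<lambda>n. ennreal (q (k n))) \<longlonglongrightarrow> 1"
      using tendsto_ennrealI[OF LIMSEQ_subseq_LIMSEQ[OF q(2) F(2)]] by (simp add: o_def)
  qed (rule ge F(3))+
  with F(1) show ?thesis by blast
qed

lemma exists_compact_with_large_tangents:
  fixes K :: "'a::euclidean_space set"
  assumes "analytic_set K" "0 \<le> s" "0 < Hausdorff_measure s K" "K \<noteq> {}"
  shows "\<exists>E. compact E \<and> E \<subseteq> K \<and> 0 < Hausdorff_measure s E \<and>
    (\<forall>x\<in>E. \<exists>F\<in>Tan (closure K) x. 1 \<le> Hausdorff_content s F)"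
proof (cases "s = 0")
  case True
  \<comment> \<open>A single point has positive measure for \<open>s = 0\<close>, and any tangent,
    being nonempty, has content at least 1.\<close>
  obtain x where "x \<in> K" using assms by blast
  then have "x \<in> closure K" using closure_subset by blast
  have "filterlim (\<lambda>n. real (Suc n)) at_top sequentially"
    by (rule filterlim_compose[OF filterlim_real_sequentially filterlim_Suc])
  then obtain F where "F \<in> Tan (closure K) x"
    using tangent_along_scales[OF closed_closure \<open>x \<in> closure K\<close>, of "\<lambda>n. real (Suc n)"] by auto
  moreover from this have "F \<noteq> {}" unfolding Tan_def by auto
  ultimately show ?thesis
    using \<open>x \<in> K\<close> Hausdorff_content_0_ge_1[of F] Hausdorff_measure_0_pos[of "{x}"] True
    by (intro exI[of _ "{x}"]) auto
next
  case False
  then have s: "0 < s" using assms by simp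
  obtain K' where K': "compact K'" "K' \<subseteq> K" "0 < Hausdorff_content s K'"
    using analytic_compact_subset[OF s assms(1,3)] by blast
  \<comment> \<open>Density thresholds below 1, as the improvement argument requires, whose limit 1
    becomes the content bound.\<close>
  define q where "q n = real (Suc n) / real (Suc (Suc n))" for n
  have q: "0 < q n" "q n < 1" for n by (auto simp: q_def)
  have lim: "q \<longlonglongrightarrow> 1" unfolding q_def using LIMSEQ_n_over_Suc_n[THEN LIMSEQ_Suc] by simp
  obtain E where E: "compact E" "E \<subseteq> K'" "0 < Hausdorff_content s E"
    and dense: "\<forall>x\<in>E. \<forall>n. \<exists>U. open U \<and> bounded U \<and> x \<in> U \<and> diameter U < 1 / real (Suc n) \<and>
       ennreal (q n) * diam_power s U < Hausdorff_content s (K' \<inter> U)"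
    by (rule compact_subset_dense_points[OF s K'(1,3), of q, OF q])
  \<comment> \<open>Densities are measured in \<open>K'\<close>, while tangents are taken of
    \<open>closure K\<close>; enlarging the set only enlarges its blow-ups.\<close>
  have "K' \<subseteq> closure K" using K'(2) closure_subset by blast
  then have "\<exists>F\<in>Tan (closure K) x. 1 \<le> Hausdorff_content s F" if "x \<in> E" for x
    using that E(2) q(1) lim dense
    by (intro exists_tangent_content_ge_1[where K = K' and q = q] s) (auto simp: less_imp_le)
  moreover have "0 < Hausdorff_measure s E"
    using E(3) Hausdorff_content_le_measure[OF s] by (rule order.strict_trans2)
  ultimately show ?thesis using E K'(2) by blast
qed

theorem theoremA:
  fixes K :: "'a::euclidean_space set"
  assumes "K \<noteq> {}"
  shows "(compact K \<longrightarrow> (\<exists>x\<in>K. pointwise_Assouad_dim K x \<ge> upper_box_dim K)) \<and>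
         (analytic_set K \<longrightarrow>
           (\<forall>s::real. s \<ge> 0 \<and> Hausdorff_measure s K > 0 \<longrightarrow>
             (\<exists>E. compact E \<and> E \<subseteq> K \<and> Hausdorff_measure s E > 0 \<and>
               (\<forall>x\<in>E. \<exists>F\<in>Tan (closure K) x. Hausdorff_content s F \<ge> 1))))"
  using exists_pointwise_Assouad_dim_ge exists_compact_with_large_tangents assms by blast

end
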